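(* Let $G$ be a finite group and $H\le G$ a subgroup. The subgroup $H$ has full induction restriction in $G$ if and only if the union $\Theta = \bigcup_{e\in E^\bullet(H)}\Theta(e)$ is irredundant, in the sense that for all $e,\tilde e\in E^\bullet(H)$, a containment $\Theta(e)\subseteq\Theta(\tilde e)$ implies $\mathbb{C}[G]e = \mathbb{C}[G]\tilde e$.
   Context: $\eta_H = |H|^{-1}\sum_{h\in H}h\in\mathbb{C}[G]$, and $E^\bullet(H)$ is the set of idempotents $e\in\mathbb{C}[H]$ with $\eta_H e=\eta_H$. For $e\in E^\bullet(H)$, $\Theta(e) = \{w\in\mathbb{C}[G] : ew(1-e)=0,\ (e-\eta_H)w\eta_H=0\}$. The subgroup $H$ has full induction restriction in $G$ if the restriction to $H$ of the permutation character of $G$ acting on the cosets of $H$ contains every irreducible complex character of $H$, i.e. $\langle\chi, \mathbb{1}_H\!\uparrow_H^G\downarrow_H\rangle\neq 0$ for every irreducible character $\chi$ of $H$, where $\uparrow_H^G$ and $\downarrow_H$ denote induction and restriction and $\mathbb{1}_H$ is the trivial character. *)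

theory Defs
  imports
    Complex_Main
    "HOL-Algebra.Ring"
    "HOL-Algebra.Coset"
    "HOL-Algebra.Left_Coset"
    "Jordan_Normal_Form.VS_Connect"
begin

section \<open>The complex group algebra\<close>

text \<open>For a finite group \<open>G\<close>, an element of \<open>\<complex>[G]\<close> is represented by its coefficient function,
  normalised to vanish outside \<open>carrier G\<close>, so that equality in \<open>\<complex>[G]\<close> is equality of functions
  and \<open>\<complex>[H]\<close> is literally a subset of \<open>\<complex>[G]\<close> for a subgroup \<open>H\<close>.\<close>

definition group_algebra :: "('a, 'b) monoid_scheme \<Rightarrow> ('a \<Rightarrow> complex) ring" where
  "group_algebra G =
    \<lparr>carrier = {f. \<forall>x. x \<notin> carrier G \<longrightarrow> f x = 0},
     mult = (\<lambda>f g x. if x \<in> carrier G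
       then (\<Sum>y\<in>carrier G. f y * g (inv\<^bsub>G\<^esub> y \<otimes>\<^bsub>G\<^esub> x)) else 0),
     one = (\<lambda>x. if x = \<one>\<^bsub>G\<^esub> then 1 else 0),
     zero = (\<lambda>x. 0),
     add = (\<lambda>f g x. f x + g x)\<rparr>"

definition eta :: "'a set \<Rightarrow> 'a \<Rightarrow> complex" where
  "eta H = (\<lambda>x. if x \<in> H then 1 / of_nat (card H) else 0)"

definition E_bullet :: "('a, 'b) monoid_scheme \<Rightarrow> 'a set \<Rightarrow> ('a \<Rightarrow> complex) set" where
  "E_bullet G H =
    {e \<in> carrier (group_algebra (G\<lparr>carrier := H\<rparr>)).
       e \<otimes>\<^bsub>group_algebra G\<^esub> e = e \<and> eta H \<otimes>\<^bsub>group_algebra G\<^esub> e = eta H}"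

definition Theta ::
  "('a, 'b) monoid_scheme \<Rightarrow> 'a set \<Rightarrow> ('a \<Rightarrow> complex) \<Rightarrow> ('a \<Rightarrow> complex) set" where
  "Theta G H e = (let A = group_algebra G in
    {w \<in> carrier A.
       e \<otimes>\<^bsub>A\<^esub> w \<otimes>\<^bsub>A\<^esub> (\<one>\<^bsub>A\<^esub> \<ominus>\<^bsub>A\<^esub> e) = \<zero>\<^bsub>A\<^esub> \<and>
       (e \<ominus>\<^bsub>A\<^esub> eta H) \<otimes>\<^bsub>A\<^esub> w \<otimes>\<^bsub>A\<^esub> eta H = \<zero>\<^bsub>A\<^esub>})"

definition left_ideal :: "('a, 'b) monoid_scheme \<Rightarrow> ('a \<Rightarrow> complex) \<Rightarrow> ('a \<Rightarrow> complex) set" where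
  "left_ideal G e = (\<lambda>a. a \<otimes>\<^bsub>group_algebra G\<^esub> e) ` carrier (group_algebra G)"


section \<open>Complex characters\<close>

text \<open>A representation of \<open>G\<close> on \<open>\<complex>\<^sup>n\<close> is a homomorphism into the general linear group, which is
  the group of units of the ring of complex \<open>n \<times> n\<close> matrices.\<close>

definition matrix_rep :: "('a, 'b) monoid_scheme \<Rightarrow> nat \<Rightarrow> ('a \<Rightarrow> complex mat) \<Rightarrow> bool" where
  "matrix_rep G n \<rho> \<longleftrightarrow> \<rho> \<in> hom G (units_of (ring_mat TYPE(complex) n ()))"

definition irreducible_rep :: "('a, 'b) monoid_scheme \<Rightarrow> nat \<Rightarrow> ('a \<Rightarrow> complex mat) \<Rightarrow> bool" where
  "irreducible_rep G n \<rho> \<longleftrightarrow> matrix_rep G n \<rho> \<and> n > 0 \<and>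
    (\<forall>W. VectorSpace.subspace class_ring W (module_vec TYPE(complex) n) \<longrightarrow>
         (\<forall>g\<in>carrier G. \<forall>v\<in>W. \<rho> g *\<^sub>v v \<in> W) \<longrightarrow>
         W = {0\<^sub>v n} \<or> W = carrier_vec n)"

definition irreducible_characters :: "('a, 'b) monoid_scheme \<Rightarrow> ('a \<Rightarrow> complex) set" where
  "irreducible_characters G =
    {restrict (\<lambda>g. \<Sum>i<n. \<rho> g $$ (i, i)) (carrier G) | n \<rho>. irreducible_rep G n \<rho>}"

definition char_inner ::
  "('a, 'b) monoid_scheme \<Rightarrow> ('a \<Rightarrow> complex) \<Rightarrow> ('a \<Rightarrow> complex) \<Rightarrow> complex" where
  "char_inner G \<phi> \<psi> = (\<Sum>g\<in>carrier G. \<phi> g * cnj (\<psi> g)) / of_nat (card (carrier G))"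

definition induced_char ::
  "('a, 'b) monoid_scheme \<Rightarrow> 'a set \<Rightarrow> ('a \<Rightarrow> complex) \<Rightarrow> 'a \<Rightarrow> complex" where
  "induced_char G H \<phi> =
    (\<lambda>g\<in>carrier G.
       (\<Sum>x | x \<in> carrier G \<and> inv\<^bsub>G\<^esub> x \<otimes>\<^bsub>G\<^esub> g \<otimes>\<^bsub>G\<^esub> x \<in> H. \<phi> (inv\<^bsub>G\<^esub> x \<otimes>\<^bsub>G\<^esub> g \<otimes>\<^bsub>G\<^esub> x))
       / of_nat (card H))"

definition full_induction_restriction :: "('a, 'b) monoid_scheme \<Rightarrow> 'a set \<Rightarrow> bool" where
  "full_induction_restriction G H \<longleftrightarrow>
    (\<forall>\<chi>\<in>irreducible_characters (G\<lparr>carrier := H\<rparr>).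
       char_inner (G\<lparr>carrier := H\<rparr>) \<chi> (restrict (induced_char G H (\<lambda>h\<in>H. 1)) H) \<noteq> 0)"


section \<open>Basic facts\<close>

lemma group_algebra_simps:
  "carrier (group_algebra G) = {f. \<forall>x. x \<notin> carrier G \<longrightarrow> f x = 0}"
  "f \<otimes>\<^bsub>group_algebra G\<^esub> g =
     (\<lambda>x. if x \<in> carrier G then (\<Sum>y\<in>carrier G. f y * g (inv\<^bsub>G\<^esub> y \<otimes>\<^bsub>G\<^esub> x)) else 0)"
  "\<one>\<^bsub>group_algebra G\<^esub> = (\<lambda>x. if x = \<one>\<^bsub>G\<^esub> then 1 else 0)"
  "\<zero>\<^bsub>group_algebra G\<^esub> = (\<lambda>x. 0)"
  "f \<oplus>\<^bsub>group_algebra G\<^esub> g = (\<lambda>x. f x + g x)"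
  by (simp_all add: group_algebra_def)

lemma group_algebra_ring:
  fixes G (structure)
  assumes "group G" and fin: "finite (carrier G)"
  shows "ring (group_algebra G)"
proof -
  interpret group G by fact
  let ?A = "group_algebra G"
  show ?thesis
  proof (rule ringI)
    show "abelian_group ?A"
    proof (rule abelian_groupI)
      fix f assume "f \<in> carrier ?A"
      then show "\<exists>g\<in>carrier ?A. g \<oplus>\<^bsub>?A\<^esub> f = \<zero>\<^bsub>?A\<^esub>"
        by (intro bexI[of _ "\<lambda>x. - f x"]) (auto simp: group_algebra_simps)
    qed (auto simp: group_algebra_simps algebra_simps)
    show "monoid ?A"
    proof (rule monoidI)
      fix f g h assume "f \<in> carrier ?A" "g \<in> carrier ?A" "h \<in> carrier ?A"
      have "(\<Sum>y\<in>carrier G. (if y \<in> carrier G then (\<Sum>z\<in>carrier G. f z * g (inv z \<otimes> y)) else 0)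
               * h (inv y \<otimes> x))
          = (\<Sum>z\<in>carrier G. f z * (if inv z \<otimes> x \<in> carrier G then
               (\<Sum>y\<in>carrier G. g y * h (inv y \<otimes> (inv z \<otimes> x))) else 0))"
        (is "?L = ?R") if x: "x \<in> carrier G" for x
      proof -
        have "?L = (\<Sum>y\<in>carrier G. \<Sum>z\<in>carrier G. f z * g (inv z \<otimes> y) * h (inv y \<otimes> x))"
          by (simp add: sum_distrib_right)
        also have "\<dots> = (\<Sum>z\<in>carrier G. \<Sum>y\<in>carrier G. f z * g (inv z \<otimes> y) * h (inv y \<otimes> x))"
          by (rule sum.swap)
        also have "\<dots> = (\<Sum>z\<in>carrier G. \<Sum>y\<in>carrier G. f z * (g y * h (inv y \<otimes> (inv z \<otimes> x))))"
        proof (rule sum.cong[OF refl])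
          fix z assume z: "z \<in> carrier G"
          have "inv a \<otimes> z \<otimes> inv z \<otimes> x = inv a \<otimes> x" if "a \<in> carrier G" for a
            using that z x by (simp add: m_assoc)
          then show "(\<Sum>y\<in>carrier G. f z * g (inv z \<otimes> y) * h (inv y \<otimes> x))
              = (\<Sum>y\<in>carrier G. f z * (g y * h (inv y \<otimes> (inv z \<otimes> x))))"
            using z x
            by (intro sum.reindex_bij_witness[where i = "\<lambda>y. z \<otimes> y" and j = "\<lambda>y. inv z \<otimes> y"])
               (auto simp: m_assoc[symmetric] inv_mult_group mult.assoc)
        qed
        also have "\<dots> = ?R"
          using x by (auto simp: sum_distrib_left intro!: sum.cong)
        finally show ?thesis .
      qed
      then show "f \<otimes>\<^bsub>?A\<^esub> g \<otimes>\<^bsub>?A\<^esub> h = f \<otimes>\<^bsub>?A\<^esub> (g \<otimes>\<^bsub>?A\<^esub> h)"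
        by (auto simp: group_algebra_simps)
    next
      fix f assume f: "f \<in> carrier ?A"
      have "(\<Sum>y\<in>carrier G. (if y = \<one> then 1 else 0) * f (inv y \<otimes> x)) = f x"
        if x: "x \<in> carrier G" for x
      proof -
        have "(\<Sum>y\<in>carrier G. (if y = \<one> then 1 else 0) * f (inv y \<otimes> x))
            = (\<Sum>y\<in>carrier G. if y = \<one> then f x else 0)"
          using x by (intro sum.cong) auto
        then show ?thesis using fin by (simp add: sum.delta)
      qed
      then show "\<one>\<^bsub>?A\<^esub> \<otimes>\<^bsub>?A\<^esub> f = f"
        using f by (auto simp: group_algebra_simps)
      have "(\<Sum>y\<in>carrier G. f y * (if inv y \<otimes> x = \<one> then 1 else 0)) = f x"
        if x: "x \<in> carrier G" for x
      proof -
        have "inv y \<otimes> x = \<one> \<longleftrightarrow> y = x" if "y \<in> carrier G" for y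
          using that x by (metis inv_closed inv_equality inv_inv l_inv)
        then have "(\<Sum>y\<in>carrier G. f y * (if inv y \<otimes> x = \<one> then 1 else 0))
            = (\<Sum>y\<in>carrier G. if y = x then f x else 0)"
          by (intro sum.cong) auto
        then show ?thesis using fin x by (simp add: sum.delta)
      qed
      then show "f \<otimes>\<^bsub>?A\<^esub> \<one>\<^bsub>?A\<^esub> = f"
        using f by (auto simp: group_algebra_simps)
    qed (auto simp: group_algebra_simps)
  qed (auto simp: group_algebra_simps fun_eq_iff distrib_left distrib_right sum.distrib)
qed

lemma group_algebra_minus:
  assumes "group G" "finite (carrier G)"
    and f: "f \<in> carrier (group_algebra G)" and g: "g \<in> carrier (group_algebra G)"
  shows "f \<ominus>\<^bsub>group_algebra G\<^esub> g = (\<lambda>x. f x - g x)"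
proof -
  interpret ring "group_algebra G" using assms by (intro group_algebra_ring)
  have "(\<lambda>x. - g x) \<in> carrier (group_algebra G)"
    and "(\<lambda>x. - g x) \<oplus>\<^bsub>group_algebra G\<^esub> g = \<zero>\<^bsub>group_algebra G\<^esub>"
    using g by (auto simp: group_algebra_simps)
  then have "\<ominus>\<^bsub>group_algebra G\<^esub> g = (\<lambda>x. - g x)"
    using g by (intro minus_equality)
  then show ?thesis by (simp add: a_minus_def group_algebra_simps)
qed

text \<open>The character induced from the trivial character is the permutation character
  on the left cosets.\<close>

lemma induced_trivial_eq_permutation_char:
  fixes G (structure)
  assumes "group G" and fin: "finite (carrier G)" and H: "subgroup H G" and g: "g \<in> carrier G"
  shows "induced_char G H (\<lambda>h\<in>H. 1) g =
    of_nat (card {C \<in> lcosets\<^bsub>G\<^esub> H. g <#\<^bsub>G\<^esub> C = C})"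
proof -
  interpret group G by fact
  interpret H: subgroup H G by fact
  let ?X = "{x \<in> carrier G. inv x \<otimes> g \<otimes> x \<in> H}"
  let ?F = "{C \<in> lcosets H. g <# C = C}"
  have fix_iff: "g <# (x <# H) = x <# H \<longleftrightarrow> inv x \<otimes> g \<otimes> x \<in> H" if x: "x \<in> carrier G" for x
  proof -
    have "g <# (x <# H) = (g \<otimes> x) <# H"
      using x g H.subset by (simp add: lcos_m_assoc)
    moreover have "(g \<otimes> x) <# H = x <# H \<longleftrightarrow> g \<otimes> x \<in> x <# H"
      using x g H by (metis l_repr_independence lcos_self m_closed)
    moreover have "g \<otimes> x \<in> x <# H \<longleftrightarrow> inv x \<otimes> g \<otimes> x \<in> H"
    proof
      assume "g \<otimes> x \<in> x <# H"
      then obtain h where "h \<in> H" "g \<otimes> x = x \<otimes> h" by (auto simp: l_coset_def)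
      then show "inv x \<otimes> g \<otimes> x \<in> H"
        using x g by (simp add: m_assoc) (simp add: m_assoc[symmetric])
    next
      assume *: "inv x \<otimes> g \<otimes> x \<in> H"
      have "g \<otimes> x = x \<otimes> (inv x \<otimes> g \<otimes> x)"
        using x g by (simp add: m_assoc[symmetric])
      then show "g \<otimes> x \<in> x <# H" using * by (auto simp: l_coset_def)
    qed
    ultimately show ?thesis by simp
  qed
  have lc: "C \<subseteq> carrier G" if "C \<in> lcosets H" for C
    using that H.subset by (auto simp: LCOSETS_def l_coset_def)
  have X: "?X = \<Union> ?F"
  proof (intro equalityI subsetI)
    fix x assume "x \<in> ?X"
    then have x: "x \<in> carrier G" and "inv x \<otimes> g \<otimes> x \<in> H" by auto
    then have "x <# H \<in> ?F" using fix_iff[OF x] by (auto simp: LCOSETS_def)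
    moreover have "x \<in> x <# H" using x H by (rule lcos_self)
    ultimately show "x \<in> \<Union> ?F" by blast
  next
    fix x assume "x \<in> \<Union> ?F"
    then obtain a where a: "a \<in> carrier G" "g <# (a <# H) = a <# H" "x \<in> a <# H"
      by (auto simp: LCOSETS_def)
    then have "x <# H = a <# H" using H by (metis l_repr_independence)
    moreover have x: "x \<in> carrier G" using a H.subset by (auto simp: l_coset_def)
    ultimately show "x \<in> ?X" using a fix_iff[OF x] by simp
  qed
  have card_F: "card (\<Union> ?F) = (\<Sum>C\<in>?F. card C)"
  proof (rule card_Union_disjoint)
    show "pairwise disjnt ?F"
      using lcos_disjoint[OF H] by (auto simp: pairwise_def disjnt_def)
    show "\<And>C. C \<in> ?F \<Longrightarrow> finite C" using lc fin finite_subset by blast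
  qed
  have card_C: "card C = card H" if C: "C \<in> ?F" for C
  proof -
    obtain a where a: "a \<in> carrier G" "C = a <# H" using C by (auto simp: LCOSETS_def)
    have "C = (\<lambda>h. a \<otimes> h) ` H" unfolding a(2) l_coset_def by blast
    moreover have "inj_on (\<lambda>h. a \<otimes> h) H"
    proof (rule inj_onI)
      fix h h' assume "h \<in> H" "h' \<in> H" "a \<otimes> h = a \<otimes> h'"
      then show "h = h'" using a(1) by simp
    qed
    ultimately show ?thesis by (metis card_image)
  qed
  have "(\<Sum>C\<in>?F. card C) = (\<Sum>C\<in>?F. card H)"
    using card_C by (rule sum.cong[OF refl])
  then have card_X: "card ?X = card ?F * card H"
    unfolding X card_F by simp
  have "card H > 0"
    using finite_subset[OF H.subset fin] H.one_closed unfolding card_gt_0_iff by blast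
  moreover have "induced_char G H (\<lambda>h\<in>H. 1) g = (\<Sum>x\<in>?X. 1) / of_nat (card H)"
    using g unfolding induced_char_def by (auto intro!: arg_cong2[where f = "(/)"] sum.cong)
  ultimately show ?thesis
    unfolding sum_constant card_X by simp
qed

end

theory Submission
  imports
    Defs
    "Jordan_Normal_Form.Spectral_Radius"
    "Jordan_Normal_Form.Schur_Decomposition"
    "HOL-Library.Function_Algebras"
begin

text \<open>Write \<open>A = \<complex>[G]\<close>, \<open>B = \<complex>[H]\<close> and \<open>\<eta> = \<eta>\<^sub>H\<close>. As a \<open>B\<close>-module, \<open>A\<eta>\<close> is the permutation
module on the cosets of \<open>H\<close>, so full induction restriction says that every simple \<open>B\<close>-module
occurs in \<open>A\<eta>\<close>. As \<open>B\<close> is semisimple, this means that \<open>A\<eta>\<close> is a faithful \<open>B\<close>-module: \<open>b A\<eta> = 0\<close>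
forces \<open>b = 0\<close>. Applying the involution \<open>h \<mapsto> h\<inverse>\<close> (conjugate-linearly extended), \<open>\<eta>A\<close> is then
faithful from the other side.

The rest is algebra with idempotents. An element \<open>e\<close> of \<open>E\<^sup>\<bullet>(H)\<close> splits as \<open>\<eta> + f\<close> with orthogonal
idempotents \<open>\<eta>\<close> and \<open>f = e - \<eta>\<close>, and \<open>\<Theta>(e)\<close> contains \<open>(1 - e)A\<close> and \<open>Af\<close>. If these lie in \<open>\<Theta>(e')\<close>,
then \<open>(e' - e'e) A\<eta> = 0\<close> and \<open>\<eta>A (e - ee') = 0\<close>, so faithfulness gives \<open>e' = e'e\<close> and \<open>e = ee'\<close>, which is
\<open>Ae = Ae'\<close> (\<open>Theta_subset_imp_left_ideal_eq\<close>). Conversely, if \<open>A\<eta>\<close> is not faithful, its annihilator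
contains an idempotent \<open>z \<noteq> 0\<close>; then \<open>\<Theta>(1 - z) \<subseteq> \<Theta>(1)\<close>, because \<open>w \<in> \<Theta>(1)\<close>
means \<open>(1 - \<eta>) w \<eta> = 0\<close>, and this element differs from \<open>(1 - z - \<eta>) w \<eta>\<close> by \<open>z w \<eta> = 0\<close>; but
\<open>A(1 - z) \<noteq> A\<close> (\<open>not_full_imp_redundant\<close>).

The link between characters and annihilators goes through the stabilisers \<open>K\<^sub>x = H \<inter> x H x\<inverse>\<close>, by
Mackey's decomposition. On the one hand \<open>b A\<eta> = 0\<close> if and only if \<open>b\<close> kills the subgroup sum
\<open>\<kappa>\<^sub>x = \<Sum>K\<^sub>x\<close> for every \<open>x\<close> (\<open>annihilates_iff\<close>). On the other hand the inner product of \<open>\<chi>\<close> with the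
permutation character is, up to a positive factor, \<open>\<Sum>\<^sub>x \<Sum>\<^bsub>k\<in>K\<^sub>x\<^esub> \<chi>(k)\<close> (\<open>char_inner_permutation\<close>),
the sum of the traces of all \<open>\<kappa>\<^sub>x\<close> on a representation with character \<open>\<chi>\<close>.
\<^item> If the annihilator is nonzero, a minimal submodule of it affords an irreducible \<open>\<chi>\<close>
(\<open>irreducible_constituent\<close>), and if the inner product is nonzero, some \<open>\<kappa>\<^sub>x\<close> does not kill that submodule.
Positivity of the involution excludes this (\<open>faithful_if_full\<close>).
\<^item> If the inner product vanishes for \<open>\<rho>\<close>, then every \<open>\<rho>(\<kappa>\<^sub>x)\<close> vanishes, since its trace is \<open>card K\<^sub>x\<close> times
the rank of a projection. A diagonal matrix coefficient of \<open>\<rho>\<close> then provides \<open>z\<close>; Schur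
orthogonality makes it idempotent (\<open>annihilating_idempotent\<close>).\<close>

section \<open>Schur's lemma and Schur orthogonality\<close>

text \<open>Invertibility of the matrices \<open>\<rho> g\<close> is automatic: \<open>\<rho> (inv g)\<close> is an inverse.\<close>

lemma (in group) matrix_rep_iff:
  "matrix_rep G n \<rho> \<longleftrightarrow>
    (\<forall>g\<in>carrier G. \<rho> g \<in> carrier_mat n n) \<and>
    (\<forall>g\<in>carrier G. \<forall>h\<in>carrier G. \<rho> (g \<otimes> h) = \<rho> g * \<rho> h) \<and> \<rho> \<one> = 1\<^sub>m n"
  (is "_ \<longleftrightarrow> ?R")
proof
  assume "matrix_rep G n \<rho>"
  then have hom: "\<rho> \<in> hom G (units_of (ring_mat TYPE(complex) n ()))"
    by (simp add: matrix_rep_def)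
  interpret R: ring "ring_mat TYPE(complex) n ()" by (rule ring_mat)
  have "group (units_of (ring_mat TYPE(complex) n ()))" by (rule R.units_group)
  from hom_one[OF hom is_group this] have "\<rho> \<one> = 1\<^sub>m n"
    by (simp add: units_of_def ring_mat_def)
  with hom show ?R
    by (auto simp: hom_def units_of_def ring_mat_def Units_def Pi_def)
next
  assume R: ?R
  have "\<rho> (inv g) * \<rho> g = 1\<^sub>m n \<and> \<rho> g * \<rho> (inv g) = 1\<^sub>m n" if "g \<in> carrier G" for g
    using R that by (metis inv_closed l_inv r_inv)
  with R show "matrix_rep G n \<rho>"
    by (auto simp: matrix_rep_def hom_def units_of_def ring_mat_def Units_def)
qed

lemma vec_subspaceI:
  fixes W :: "complex vec set"
  assumes "W \<subseteq> carrier_vec n" "0\<^sub>v n \<in> W"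
    and "\<And>v w. v \<in> W \<Longrightarrow> w \<in> W \<Longrightarrow> v + w \<in> W"
    and "\<And>c v. v \<in> W \<Longrightarrow> c \<cdot>\<^sub>v v \<in> W"
  shows "VectorSpace.subspace class_ring W (module_vec TYPE(complex) n)"
  using assms
  by (auto simp: VectorSpace.subspace_def submodule_def vec_vs vec_module module_vec_simps)

lemma vec_subspaceD:
  fixes W :: "complex vec set"
  assumes "VectorSpace.subspace class_ring W (module_vec TYPE(complex) n)"
  shows "W \<subseteq> carrier_vec n" "0\<^sub>v n \<in> W"
    and "v \<in> W \<Longrightarrow> w \<in> W \<Longrightarrow> v + w \<in> W"
    and "v \<in> W \<Longrightarrow> c \<cdot>\<^sub>v v \<in> W"
  using assms
  by (auto simp: VectorSpace.subspace_def submodule_def vec_vs vec_module module_vec_simps)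

text \<open>An eigenspace of \<open>M\<close>, which exists over the complex numbers, is invariant under \<open>\<rho>\<close>, hence everything.\<close>

lemma (in group) schur_lemma:
  assumes irr: "irreducible_rep G n \<rho>" and M: "M \<in> carrier_mat n n"
    and comm: "\<And>g. g \<in> carrier G \<Longrightarrow> \<rho> g * M = M * \<rho> g"
  shows "\<exists>c. M = c \<cdot>\<^sub>m 1\<^sub>m n"
proof -
  have n: "n > 0" and rep: "\<And>g. g \<in> carrier G \<Longrightarrow> \<rho> g \<in> carrier_mat n n"
    using irr by (auto simp: irreducible_rep_def matrix_rep_iff)
  from spectrum_non_empty[OF M n] obtain c v where v: "eigenvector M v c"
    by (auto simp: spectrum_def eigenvalue_def)
  define W where "W = {v \<in> carrier_vec n. M *\<^sub>v v = c \<cdot>\<^sub>v v}"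
  have "VectorSpace.subspace class_ring W (module_vec TYPE(complex) n)"
    using M by (intro vec_subspaceI)
      (auto simp: W_def mult_add_distrib_mat_vec mult_mat_vec smult_add_distrib_vec
        smult_smult_assoc mult.commute)
  moreover have "\<rho> g *\<^sub>v w \<in> W" if g: "g \<in> carrier G" and w: "w \<in> W" for g w
  proof -
    have w': "w \<in> carrier_vec n" "M *\<^sub>v w = c \<cdot>\<^sub>v w" using w by (auto simp: W_def)
    have "M *\<^sub>v (\<rho> g *\<^sub>v w) = (\<rho> g * M) *\<^sub>v w"
      unfolding comm[OF g] by (rule assoc_mult_mat_vec[OF M rep[OF g] w'(1), symmetric])
    also have "\<dots> = \<rho> g *\<^sub>v (c \<cdot>\<^sub>v w)"
      using assoc_mult_mat_vec[OF rep[OF g] M w'(1)] w'(2) by simp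
    also have "\<dots> = c \<cdot>\<^sub>v (\<rho> g *\<^sub>v w)"
      using mult_mat_vec[OF rep[OF g] w'(1)] .
    finally show ?thesis using rep[OF g] w' by (auto simp: W_def)
  qed
  ultimately have "W = {0\<^sub>v n} \<or> W = carrier_vec n"
    using irr by (auto simp: irreducible_rep_def)
  moreover have "v \<in> W" "v \<noteq> 0\<^sub>v n"
    using v M by (auto simp: eigenvector_def W_def)
  ultimately have W: "W = carrier_vec n" by auto
  have "M = c \<cdot>\<^sub>m 1\<^sub>m n"
  proof (rule eq_matI)
    fix i j assume ij: "i < dim_row (c \<cdot>\<^sub>m 1\<^sub>m n)" "j < dim_col (c \<cdot>\<^sub>m 1\<^sub>m n)"
    have "unit_vec n j \<in> W" unfolding W by simp
    then have "M *\<^sub>v unit_vec n j = c \<cdot>\<^sub>v unit_vec n j" by (simp add: W_def)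
    then have "(M *\<^sub>v unit_vec n j) $ i = c * (unit_vec n j $ i)" using ij by simp
    moreover have "(M *\<^sub>v unit_vec n j) $ i = M $$ (i, j)"
      using ij M by (simp add: scalar_prod_right_unit)
    ultimately show "M $$ (i, j) = (c \<cdot>\<^sub>m 1\<^sub>m n) $$ (i, j)" using ij by simp
  qed (use M in auto)
  then show ?thesis ..
qed

lemma (in group) matrix_rep_mult_entry:
  assumes "matrix_rep G n \<rho>" "g \<in> carrier G" "h \<in> carrier G" "i < n" "j < n"
  shows "\<rho> (g \<otimes> h) $$ (i, j) = (\<Sum>l<n. \<rho> g $$ (i, l) * \<rho> h $$ (l, j))"
proof -
  have c: "\<rho> g \<in> carrier_mat n n" "\<rho> h \<in> carrier_mat n n" and "\<rho> (g \<otimes> h) = \<rho> g * \<rho> h"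
    using assms by (auto simp: matrix_rep_iff)
  then show ?thesis using assms(4,5)
    by (simp add: scalar_prod_def lessThan_atLeast0)
qed

text \<open>Averaging the matrix unit with its entry at position \<open>(a, b)\<close> over the group gives the matrix \<open>M\<close> with
entries the left-hand side, which commutes with \<open>\<rho>\<close>. So it is a scalar matrix, and its trace,
which is \<open>card G\<close> times that of the matrix unit, determines the scalar.\<close>

lemma (in group) schur_orthogonality:
  assumes fin: "finite (carrier G)" and irr: "irreducible_rep G n \<rho>"
    and idx: "p < n" "a < n" "b < n" "q < n"
  shows "(\<Sum>y\<in>carrier G. \<rho> (inv y) $$ (p, a) * \<rho> y $$ (b, q)) =
    (if p = q \<and> a = b then of_nat (card (carrier G)) / of_nat n else 0)"
proof -
  have rep: "matrix_rep G n \<rho>" and n: "n > 0" using irr by (auto simp: irreducible_rep_def)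
  note mult = matrix_rep_mult_entry[OF rep]
  have car: "\<And>g. g \<in> carrier G \<Longrightarrow> \<rho> g \<in> carrier_mat n n" and one: "\<rho> \<one> = 1\<^sub>m n"
    using rep by (auto simp: matrix_rep_iff)
  define M where "M = mat n n (\<lambda>(p, q). \<Sum>y\<in>carrier G. \<rho> (inv y) $$ (p, a) * \<rho> y $$ (b, q))"
  have M: "M \<in> carrier_mat n n" by (simp add: M_def)
  have "\<rho> g * M = M * \<rho> g" if g: "g \<in> carrier G" for g
  proof (rule eq_matI)
    fix i j assume "i < dim_row (M * \<rho> g)" "j < dim_col (M * \<rho> g)"
    then have ij: "i < n" "j < n" using M car[OF g] by auto
    have "(\<rho> g * M) $$ (i, j) = (\<Sum>l<n. \<rho> g $$ (i, l) * M $$ (l, j))"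
      using ij M car[OF g] by (simp add: scalar_prod_def lessThan_atLeast0)
    also have "\<dots> = (\<Sum>y\<in>carrier G. (\<Sum>l<n. \<rho> g $$ (i, l) * \<rho> (inv y) $$ (l, a)) * \<rho> y $$ (b, j))"
      using ij by (simp add: M_def sum_distrib_left sum_distrib_right mult.assoc)
        (rule sum.swap)
    also have "\<dots> = (\<Sum>y\<in>carrier G. \<rho> (g \<otimes> inv y) $$ (i, a) * \<rho> y $$ (b, j))"
      using g ij idx by (intro sum.cong refl) (simp add: mult)
    also have "\<dots> = (\<Sum>y\<in>carrier G. \<rho> (inv y) $$ (i, a) * \<rho> (y \<otimes> g) $$ (b, j))"
      using g by (intro sum.reindex_bij_witness[where i = "\<lambda>y. y \<otimes> g" and j = "\<lambda>y. y \<otimes> inv g"])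
        (auto simp: m_assoc inv_mult_group)
    also have "\<dots> = (\<Sum>y\<in>carrier G. \<rho> (inv y) $$ (i, a) * (\<Sum>l<n. \<rho> y $$ (b, l) * \<rho> g $$ (l, j)))"
      using g ij idx by (intro sum.cong refl) (simp add: mult)
    also have "\<dots> = (\<Sum>l<n. M $$ (i, l) * \<rho> g $$ (l, j))"
      using ij by (simp add: M_def sum_distrib_left sum_distrib_right mult.assoc)
        (rule sum.swap)
    also have "\<dots> = (M * \<rho> g) $$ (i, j)"
      using ij M car[OF g] by (simp add: scalar_prod_def lessThan_atLeast0)
    finally show "(\<rho> g * M) $$ (i, j) = (M * \<rho> g) $$ (i, j)" .
  qed (use M car[OF g] in auto)
  from schur_lemma[OF irr M this] obtain c where c: "M = c \<cdot>\<^sub>m 1\<^sub>m n" by auto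
  have "of_nat n * c = (\<Sum>p<n. M $$ (p, p))" by (simp add: c)
  also have "\<dots> = (\<Sum>y\<in>carrier G. \<Sum>p<n. \<rho> y $$ (b, p) * \<rho> (inv y) $$ (p, a))"
    by (simp add: M_def mult.commute) (rule sum.swap)
  also have "\<dots> = (\<Sum>y\<in>carrier G. \<rho> (y \<otimes> inv y) $$ (b, a))"
    using idx by (intro sum.cong refl mult[symmetric]) auto
  also have "\<dots> = (if a = b then of_nat (card (carrier G)) else 0)"
    using idx by (simp add: one)
  finally have "c = (if a = b then of_nat (card (carrier G)) / of_nat n else 0)"
    using n by (auto simp: field_simps)
  moreover have "(\<Sum>y\<in>carrier G. \<rho> (inv y) $$ (p, a) * \<rho> y $$ (b, q)) = M $$ (p, q)"
    using idx by (simp add: M_def)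
  ultimately show ?thesis using idx by (simp add: c)
qed

section \<open>Traces of idempotents and of subgroup sums\<close>

text \<open>Such a matrix is nilpotent. Concretely, \<open>T\<^sub>i\<^sub>j = \<Sum>\<^sub>l T\<^sub>i\<^sub>l T\<^sub>l\<^sub>j\<close> involves only entries closer to the diagonal.\<close>

lemma strictly_upper_triangular_idempotent:
  fixes T :: "complex mat"
  assumes T: "T \<in> carrier_mat n n" and tri: "upper_triangular T"
    and diag: "\<And>i. i < n \<Longrightarrow> T $$ (i, i) = 0" and idem: "T * T = T"
  shows "T = 0\<^sub>m n n"
proof -
  have prod: "T $$ (i, j) = (\<Sum>l<n. T $$ (i, l) * T $$ (l, j))" if "i < n" "j < n" for i j
    using that T arg_cong[OF idem, of "\<lambda>M. M $$ (i, j)"]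
    by (simp add: scalar_prod_def lessThan_atLeast0)
  have "T $$ (i, j) = 0" if "i < n" "j < n" for i j
    using that
  proof (induction "j - i" arbitrary: i j rule: less_induct)
    case less
    have "T $$ (i, l) * T $$ (l, j) = 0" if l: "l < n" for l
    proof -
      consider "l < i" | "l = i" | "j \<le> l" | "i < l" "l < j" by linarith
      then show ?thesis
      proof cases
        case 1
        then show ?thesis using tri T less.prems by (simp add: upper_triangularD)
      next
        case 2
        then show ?thesis using diag less.prems by simp
      next
        case 3
        then have "T $$ (l, j) = 0"
          using tri T l diag[of j] less.prems by (cases "l = j") (auto simp: upper_triangularD)
        then show ?thesis by simp
      next
        case 4
        then have "T $$ (i, l) = 0" using less.hyps[of l i] l less.prems by simp
        then show ?thesis by simp
      qed
    qed
    then show ?case unfolding prod[OF less.prems] by (intro sum.neutral) simp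
  qed
  then show ?thesis using T by (intro eq_matI) auto
qed

lemma trace_mult_commute:
  fixes A B :: "complex mat"
  assumes "A \<in> carrier_mat n n" "B \<in> carrier_mat n n"
  shows "(\<Sum>i<n. (A * B) $$ (i, i)) = (\<Sum>i<n. (B * A) $$ (i, i))"
proof -
  have "(\<Sum>i<n. (A * B) $$ (i, i)) = (\<Sum>i<n. \<Sum>l<n. A $$ (i, l) * B $$ (l, i))"
    using assms by (simp add: scalar_prod_def lessThan_atLeast0)
  also have "\<dots> = (\<Sum>l<n. \<Sum>i<n. B $$ (l, i) * A $$ (i, l))"
    by (subst sum.swap) (simp add: mult.commute)
  also have "\<dots> = (\<Sum>i<n. (B * A) $$ (i, i))"
    using assms by (simp add: scalar_prod_def lessThan_atLeast0)
  finally show ?thesis .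
qed

text \<open>Triangularise \<open>P\<close>: the diagonal entries of an upper triangular idempotent are idempotent
numbers, so its trace counts the ones on the diagonal. The number \<open>r\<close> is the rank of \<open>P\<close>.\<close>

lemma idempotent_trace:
  fixes P :: "complex mat"
  assumes P: "P \<in> carrier_mat n n" and idem: "P * P = P"
  obtains r :: nat where "(\<Sum>i<n. P $$ (i, i)) = of_nat r" and "r = 0 \<Longrightarrow> P = 0\<^sub>m n n"
proof -
  obtain es where "char_poly P = (\<Prod>a\<leftarrow>es. [:- a, 1:])" using char_poly_factorized[OF P] by auto
  from schur_decomposition_exists[OF P this] obtain T
    where T: "T \<in> carrier_mat n n" and tri: "upper_triangular T" and "similar_mat P T" by auto
  then obtain Q R where wit: "similar_mat_wit P T Q R" by (auto simp: similar_mat_def)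
  note w = similar_mat_witD2[OF P wit]
  have TRPQ: "T = R * P * Q"
  proof -
    have "R * P * Q = R * (Q * T * R) * Q" using w by simp
    also have "\<dots> = (R * Q) * (T * (R * Q))"
      using w(4-7) by (simp only: assoc_mult_mat[of _ n n _ n _ n] mult_carrier_mat[of _ n n _ n])
    also have "\<dots> = T" using w by simp
    finally show ?thesis ..
  qed
  have TT: "T * T = T"
  proof -
    have "T * T = R * P * (Q * R) * P * Q"
      using w(4-7) P unfolding TRPQ
      by (simp only: assoc_mult_mat[of _ n n _ n _ n] mult_carrier_mat[of _ n n _ n])
    also have "\<dots> = R * (P * P) * Q"
      using w(4-7) P unfolding w(1)
      by (simp add: assoc_mult_mat[of _ n n _ n _ n])
    finally show ?thesis using idem TRPQ by simp
  qed
  have trace: "(\<Sum>i<n. P $$ (i, i)) = (\<Sum>i<n. T $$ (i, i))"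
  proof -
    have "(\<Sum>i<n. P $$ (i, i)) = (\<Sum>i<n. (Q * (T * R)) $$ (i, i))"
      using w by (simp add: assoc_mult_mat[of _ n n _ n _ n])
    also have "\<dots> = (\<Sum>i<n. (T * R * Q) $$ (i, i))"
      using w by (intro trace_mult_commute) auto
    also have "T * R * Q = T" using w by (simp add: assoc_mult_mat[of _ n n _ n _ n])
    finally show ?thesis .
  qed
  have diag: "T $$ (i, i) \<in> {0, 1}" if i: "i < n" for i
  proof -
    have "T $$ (i, i) = (\<Sum>l<n. T $$ (i, l) * T $$ (l, i))"
      using i T arg_cong[OF TT, of "\<lambda>M. M $$ (i, i)"]
      by (simp add: scalar_prod_def lessThan_atLeast0)
    also have "\<dots> = (\<Sum>l<n. if l = i then T $$ (i, i) * T $$ (i, i) else 0)"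
    proof (intro sum.cong refl)
      fix l assume "l \<in> {..<n}"
      then show "T $$ (i, l) * T $$ (l, i) = (if l = i then T $$ (i, i) * T $$ (i, i) else 0)"
        using tri T i by (cases l i rule: linorder_cases) (auto simp: upper_triangularD)
    qed
    finally show ?thesis using i by auto
  qed
  define r where "r = card {i. i < n \<and> T $$ (i, i) = 1}"
  have "(\<Sum>i<n. T $$ (i, i)) = (\<Sum>i<n. if T $$ (i, i) = 1 then 1 else 0)"
    using diag by (intro sum.cong refl) auto
  also have "\<dots> = of_nat r" by (simp add: r_def sum.If_cases Int_def)
  finally have "(\<Sum>i<n. P $$ (i, i)) = of_nat r" using trace by simp
  moreover have "P = 0\<^sub>m n n" if "r = 0"
  proof -
    have "T $$ (i, i) = 0" if "i < n" for i
      using \<open>r = 0\<close> diag[OF that] that by (auto simp: r_def)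
    then have "T = 0\<^sub>m n n" by (rule strictly_upper_triangular_idempotent[OF T tri _ TT])
    then show ?thesis using w by simp
  qed
  ultimately show ?thesis by (rule that)
qed

text \<open>The average of \<open>\<rho>\<close> over \<open>S\<close> is an idempotent (the projection onto the \<open>S\<close>-fixed vectors). That the sum of
the character over \<open>S\<close> is a natural number is what later excludes cancellation between the
contributions of different subgroups.\<close>

lemma (in group) subgroup_character_sum:
  assumes rep: "matrix_rep G n \<rho>" and S: "subgroup S G" and fin: "finite S"
  obtains r :: nat where "(\<Sum>k\<in>S. \<Sum>i<n. \<rho> k $$ (i, i)) = of_nat (card S * r)"
    and "\<And>i j. r = 0 \<Longrightarrow> i < n \<Longrightarrow> j < n \<Longrightarrow> (\<Sum>k\<in>S. \<rho> k $$ (i, j)) = 0"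
proof -
  interpret S: subgroup S G by fact
  have card: "card S > 0" using fin S.one_closed unfolding card_gt_0_iff by blast
  define c :: complex where "c = of_nat (card S)"
  have c: "c \<noteq> 0" using card by (simp add: c_def)
  define P where "P = mat n n (\<lambda>(i, j). (\<Sum>k\<in>S. \<rho> k $$ (i, j)) / c)"
  have P: "P \<in> carrier_mat n n" by (simp add: P_def)
  have "P * P = P"
  proof (rule eq_matI)
    fix i j assume "i < dim_row P" "j < dim_col P"
    then have ij: "i < n" "j < n" by (auto simp: P_def)
    have "(P * P) $$ (i, j) =
        (\<Sum>l<n. (\<Sum>k\<in>S. \<rho> k $$ (i, l)) * (\<Sum>k\<in>S. \<rho> k $$ (l, j))) / (c * c)"
      using ij by (simp add: P_def scalar_prod_def lessThan_atLeast0 sum_divide_distrib[symmetric])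
    also have "\<dots> = (\<Sum>l<n. \<Sum>k\<in>S. \<Sum>k'\<in>S. \<rho> k $$ (i, l) * \<rho> k' $$ (l, j)) / (c * c)"
      by (simp add: sum_product)
    also have "\<dots> = (\<Sum>k\<in>S. \<Sum>k'\<in>S. \<Sum>l<n. \<rho> k $$ (i, l) * \<rho> k' $$ (l, j)) / (c * c)"
      by (subst sum.swap, subst (2) sum.swap) simp
    also have "\<dots> = (\<Sum>k\<in>S. \<Sum>k'\<in>S. \<rho> (k \<otimes> k') $$ (i, j)) / (c * c)"
      using ij by (simp add: matrix_rep_mult_entry[OF rep])
    also have "\<dots> = (\<Sum>k\<in>S. \<Sum>k'\<in>S. \<rho> k' $$ (i, j)) / (c * c)"
    proof -
      have "(\<Sum>k'\<in>S. \<rho> (k \<otimes> k') $$ (i, j)) = (\<Sum>k'\<in>S. \<rho> k' $$ (i, j))" if "k \<in> S" for k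
        using that
        by (intro sum.reindex_bij_witness[where i = "\<lambda>y. inv k \<otimes> y" and j = "\<lambda>y. k \<otimes> y"])
          (auto simp: m_assoc[symmetric])
      then show ?thesis by simp
    qed
    also have "\<dots> = P $$ (i, j)" using ij c by (simp add: P_def c_def[symmetric])
    finally show "(P * P) $$ (i, j) = P $$ (i, j)" .
  qed (simp_all add: P_def)
  then obtain r :: nat where r: "(\<Sum>i<n. P $$ (i, i)) = of_nat r" "r = 0 \<Longrightarrow> P = 0\<^sub>m n n"
    using idempotent_trace[OF P] by blast
  have entry: "(\<Sum>k\<in>S. \<rho> k $$ (i, j)) = c * P $$ (i, j)" if "i < n" "j < n" for i j
    using that c by (simp add: P_def)
  have "(\<Sum>k\<in>S. \<Sum>i<n. \<rho> k $$ (i, i)) = (\<Sum>i<n. c * P $$ (i, i))"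
    by (subst sum.swap) (simp add: entry)
  also have "\<dots> = of_nat (card S * r)"
    by (simp add: sum_distrib_left[symmetric] r(1) c_def)
  finally show ?thesis using that[of r] r(2) entry by simp
qed

section \<open>Irreducible constituents\<close>

text \<open>Choose a nonzero stable subspace \<open>M\<close> of least dimension. Its coordinates with respect to a basis \<open>b\<close> turn the
action into matrices \<open>\<rho>\<close>. A subspace of \<open>\<complex>\<^sup>n\<close> stable under \<open>\<rho>\<close> corresponds to a stable subspace of \<open>M\<close>, which by
minimality is zero or all of \<open>M\<close>.\<close>

lemma (in group) irreducible_constituent:
  fixes scale :: "complex \<Rightarrow> 'v::ab_group_add \<Rightarrow> 'v" and act :: "'a \<Rightarrow> 'v \<Rightarrow> 'v"
  assumes "vector_space scale"
    and L: "module.subspace scale L" "L \<subseteq> module.span scale F" "finite F" "L \<noteq> {0}"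
    and act_in: "\<And>g v. g \<in> carrier G \<Longrightarrow> v \<in> L \<Longrightarrow> act g v \<in> L"
    and act_add: "\<And>g v w. g \<in> carrier G \<Longrightarrow> v \<in> L \<Longrightarrow> w \<in> L \<Longrightarrow> act g (v + w) = act g v + act g w"
    and act_scale: "\<And>g c v. g \<in> carrier G \<Longrightarrow> v \<in> L \<Longrightarrow> act g (scale c v) = scale c (act g v)"
    and act_mult: "\<And>g h v. g \<in> carrier G \<Longrightarrow> h \<in> carrier G \<Longrightarrow> v \<in> L \<Longrightarrow>
        act (g \<otimes> h) v = act g (act h v)"
    and act_one: "\<And>v. v \<in> L \<Longrightarrow> act \<one> v = v"
  obtains n \<rho> b where "irreducible_rep G n \<rho>" and "\<And>j. j < n \<Longrightarrow> b j \<in> L"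
    and "\<And>c. (\<Sum>j<n. scale (c j) (b j)) = 0 \<Longrightarrow> \<forall>j<n. c j = 0"
    and "\<And>g j. g \<in> carrier G \<Longrightarrow> j < n \<Longrightarrow> act g (b j) = (\<Sum>i<n. scale (\<rho> g $$ (i, j)) (b i))"
proof -
  interpret vs: vector_space scale by fact
  define stable where "stable M \<longleftrightarrow> vs.subspace M \<and> M \<subseteq> L \<and> M \<noteq> {0} \<and>
    (\<forall>g\<in>carrier G. \<forall>v\<in>M. act g v \<in> M)" for M
  have "stable L" using L act_in by (auto simp: stable_def)
  then obtain M where M: "stable M" and least: "\<And>N. stable N \<Longrightarrow> vs.dim M \<le> vs.dim N"
    using ex_has_least_nat[of stable L vs.dim] by blast
  have M_sub: "vs.subspace M" and M_le_L: "M \<subseteq> L" and M0: "M \<noteq> {0}"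
    and M_act: "\<And>g v. g \<in> carrier G \<Longrightarrow> v \<in> M \<Longrightarrow> act g v \<in> M"
    using M by (auto simp: stable_def)
  obtain B where B: "B \<subseteq> M" "vs.independent B" "M \<subseteq> vs.span B" "card B = vs.dim M"
    by (rule vs.basis_exists)
  have fin_indep: "finite C" if "C \<subseteq> M" "vs.independent C" for C
    using vs.independent_span_bound[OF L(3) that(2)] that(1) M_le_L L(2) by auto
  have finB: "finite B" using fin_indep B by blast
  define n where "n = card B"
  obtain b where b: "bij_betw b {..<n} B"
    using ex_bij_betw_nat_finite[OF finB] by (auto simp: n_def lessThan_atLeast0)
  have bM: "b j \<in> M" if "j < n" for j using b that B(1) by (auto simp: bij_betw_def)
  have bL: "b j \<in> L" if "j < n" for j using bM[OF that] M_le_L by auto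
  have comb: "(\<Sum>j<n. scale (c j) (b j)) \<in> M" for c
    using bM by (intro vs.subspace_sum[OF M_sub] vs.subspace_scale[OF M_sub]) auto
  have indep: "\<forall>j<n. c j = 0" if "(\<Sum>j<n. scale (c j) (b j)) = 0" for c
  proof -
    define c' where "c' = c \<circ> inv_into {..<n} b"
    have c': "c' (b j) = c j" if "j < n" for j
      using b that by (simp add: c'_def bij_betw_def inv_into_f_f)
    have "(\<Sum>v\<in>B. scale (c' v) v) = (\<Sum>j<n. scale (c' (b j)) (b j))"
      by (rule sum.reindex_bij_betw[OF b, symmetric])
    also have "\<dots> = 0" using that c' by simp
    finally have "\<forall>v\<in>B. c' v = 0"
      using B(2) finB vs.dependent_finite by blast
    then show ?thesis using c' b by (auto simp: bij_betw_def)
  qed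
  have unique: "c i = d i"
    if "(\<Sum>j<n. scale (c j) (b j)) = (\<Sum>j<n. scale (d j) (b j))" "i < n" for c d i
    using indep[of "\<lambda>j. c j - d j"] that
    by (simp add: vs.scale_left_diff_distrib sum_subtractf)
  define coord where "coord v i = vs.representation B v (b i)" for v i
  have coord: "(\<Sum>j<n. scale (coord v j) (b j)) = v" if "v \<in> M" for v
  proof -
    have "(\<Sum>j<n. scale (coord v j) (b j)) = (\<Sum>u\<in>B. scale (vs.representation B v u) u)"
      unfolding coord_def by (rule sum.reindex_bij_betw[OF b])
    also have "\<dots> = v" using B that finB by (intro vs.sum_representation_eq) auto
    finally show ?thesis .
  qed
  have act_sum: "act g (\<Sum>j\<in>J. scale (c j) (b j)) = (\<Sum>j\<in>J. scale (c j) (act g (b j)))"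
    if g: "g \<in> carrier G" and J: "J \<subseteq> {..<n}" for g c J
  proof -
    have "finite J" using J finite_subset by blast
    then show ?thesis using J
    proof induction
      case empty
      have "0 \<in> L" using L(1) by (rule vs.subspace_0)
      then show ?case using act_add[OF g, of 0 0] by simp
    next
      case (insert j J)
      have "scale (c j) (b j) \<in> L" "b j \<in> L" "(\<Sum>j\<in>J. scale (c j) (b j)) \<in> L"
        using insert.prems bM M_le_L L(1)
        by (auto intro!: vs.subspace_scale[OF L(1)] vs.subspace_sum[OF L(1)])
      then show ?case using insert act_add[OF g] act_scale[OF g] by simp
    qed
  qed
  define \<rho> where "\<rho> g = mat n n (\<lambda>(i, j). coord (act g (b j)) i)" for g
  have \<rho>_act: "act g (b j) = (\<Sum>i<n. scale (\<rho> g $$ (i, j)) (b i))"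
    if "g \<in> carrier G" "j < n" for g j
    using coord[OF M_act[OF that(1) bM[OF that(2)]]] that by (simp add: \<rho>_def)
  have \<rho>_car: "\<rho> g \<in> carrier_mat n n" for g by (simp add: \<rho>_def)
  have act_vec: "act g (\<Sum>j<n. scale (w $ j) (b j)) = (\<Sum>i<n. scale ((\<rho> g *\<^sub>v w) $ i) (b i))"
    if g: "g \<in> carrier G" and w: "w \<in> carrier_vec n" for g w
  proof -
    have "act g (\<Sum>j<n. scale (w $ j) (b j)) =
        (\<Sum>j<n. \<Sum>i<n. scale (w $ j * \<rho> g $$ (i, j)) (b i))"
      using g by (simp add: act_sum \<rho>_act vs.scale_sum_right)
    also have "\<dots> = (\<Sum>i<n. scale (\<Sum>j<n. w $ j * \<rho> g $$ (i, j)) (b i))"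
      by (subst sum.swap) (simp add: vs.scale_sum_left)
    also have "\<dots> = (\<Sum>i<n. scale ((\<rho> g *\<^sub>v w) $ i) (b i))"
      using w \<rho>_car[of g]
      by (intro sum.cong refl arg_cong2[where f = scale])
        (auto simp: scalar_prod_def lessThan_atLeast0 mult.commute intro!: sum.cong)
    finally show ?thesis .
  qed
  have rep: "matrix_rep G n \<rho>"
    unfolding matrix_rep_iff
  proof (intro conjI ballI)
    fix g h assume g: "g \<in> carrier G" and h: "h \<in> carrier G"
    show "\<rho> (g \<otimes> h) = \<rho> g * \<rho> h"
    proof (rule eq_matI)
      fix i j assume "i < dim_row (\<rho> g * \<rho> h)" "j < dim_col (\<rho> g * \<rho> h)"
      then have i: "i < n" and j: "j < n" using \<rho>_car[of g] \<rho>_car[of h] by auto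
      have "(\<Sum>i<n. scale (\<rho> (g \<otimes> h) $$ (i, j)) (b i)) = act g (act h (b j))"
        using \<rho>_act[of "g \<otimes> h" j] g h j act_mult[OF g h bL[OF j]] by simp
      also have "act h (b j) = (\<Sum>i<n. scale (col (\<rho> h) j $ i) (b i))"
        using \<rho>_act[OF h j] \<rho>_car[of h] j by simp
      also have "act g \<dots> = (\<Sum>i<n. scale ((\<rho> g *\<^sub>v col (\<rho> h) j) $ i) (b i))"
        using g \<rho>_car[of h] j by (intro act_vec) auto
      finally have "\<rho> (g \<otimes> h) $$ (i, j) = (\<rho> g *\<^sub>v col (\<rho> h) j) $ i"
        using i by (rule unique)
      then show "\<rho> (g \<otimes> h) $$ (i, j) = (\<rho> g * \<rho> h) $$ (i, j)"
        using i j \<rho>_car[of g] \<rho>_car[of h] by simp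
    qed (simp_all add: \<rho>_def)
  next
    show "\<rho> \<one> = 1\<^sub>m n"
    proof (rule eq_matI)
      fix i j assume "i < dim_row (1\<^sub>m n)" "j < dim_col (1\<^sub>m n)"
      then have i: "i < n" and j: "j < n" by auto
      have "(\<Sum>i<n. scale (\<rho> \<one> $$ (i, j)) (b i)) = b j"
        using \<rho>_act[of \<one> j] j act_one[OF bL[OF j]] by simp
      also have "\<dots> = (\<Sum>i<n. scale (if i = j then 1 else 0) (b i))"
      proof -
        have "(\<Sum>i<n. scale (if i = j then 1 else 0) (b i)) = (\<Sum>i<n. if i = j then b i else 0)"
          by (intro sum.cong) auto
        then show ?thesis using j by simp
      qed
      finally have "\<rho> \<one> $$ (i, j) = (if i = j then 1 else 0)" using i by (rule unique)
      then show "\<rho> \<one> $$ (i, j) = 1\<^sub>m n $$ (i, j)" using i j by simp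
    qed (simp_all add: \<rho>_def)
  qed (rule \<rho>_car)
  have "n > 0"
  proof (rule ccontr)
    assume "\<not> n > 0"
    then have "M \<subseteq> {0}" using coord by fastforce
    then show False using M0 vs.subspace_0[OF M_sub] by auto
  qed
  moreover have "W = {0\<^sub>v n} \<or> W = carrier_vec n"
    if W: "VectorSpace.subspace class_ring W (module_vec TYPE(complex) n)"
      and W_act: "\<And>g w. g \<in> carrier G \<Longrightarrow> w \<in> W \<Longrightarrow> \<rho> g *\<^sub>v w \<in> W" for W
  proof -
    note W = vec_subspaceD[OF W]
    \<comment> \<open>the linear isomorphism from coordinate vectors to \<open>M\<close>\<close>
    define val where "val w = (\<Sum>j<n. scale (w $ j) (b j))" for w
    have val_inj: "w = w'" if "val w = val w'" "w \<in> carrier_vec n" "w' \<in> carrier_vec n" for w w'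
      using that unique unfolding val_def by (intro eq_vecI) auto
    have val_0: "val (0\<^sub>v n) = 0" by (simp add: val_def)
    have val_add: "val (v + w) = val v + val w" if "v \<in> W" "w \<in> W" for v w
      using that W(1) by (auto simp: val_def vs.scale_left_distrib sum.distrib[symmetric] intro!: sum.cong)
    have val_scale: "val (c \<cdot>\<^sub>v v) = scale c (val v)" if "v \<in> W" for c v
      using that W(1) by (auto simp: val_def vs.scale_sum_right intro!: sum.cong)
    define N where "N = val ` W"
    have NM: "N \<subseteq> M" using comb by (auto simp: N_def val_def)
    have N_sub: "vs.subspace N"
    proof (rule vs.subspaceI)
      show "0 \<in> N" using W(2) val_0 unfolding N_def by force
      show "x + y \<in> N" if "x \<in> N" "y \<in> N" for x y
        using that W(3) unfolding N_def by (force simp: val_add[symmetric])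
      show "scale c x \<in> N" if "x \<in> N" for c x
        using that W(4) unfolding N_def by (force simp: val_scale[symmetric])
    qed
    have N_act: "act g x \<in> N" if "g \<in> carrier G" "x \<in> N" for g x
      using that W_act W(1) act_vec unfolding N_def val_def by fastforce
    show ?thesis
    proof (cases "N = {0}")
      case True
      then have "w = 0\<^sub>v n" if "w \<in> W" for w
        using that W(1) val_0 by (intro val_inj) (auto simp: N_def)
      then show ?thesis using W(2) by blast
    next
      case False
      then have "stable N" using N_sub NM M_le_L N_act by (auto simp: stable_def)
      then have dim: "vs.dim M \<le> vs.dim N" by (rule least)
      obtain C where C: "C \<subseteq> N" "vs.independent C" "N \<subseteq> vs.span C" "card C = vs.dim N"
        by (rule vs.basis_exists)
      obtain D where D: "C \<subseteq> D" "D \<subseteq> M" "vs.independent D" "M \<subseteq> vs.span D"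
        by (rule vs.maximal_independent_subset_extend[OF subset_trans[OF C(1) NM] C(2)])
      \<comment> \<open>minimality leaves no room to extend a basis of \<open>N\<close> to a larger one of \<open>M\<close>\<close>
      have "card D \<le> card C"
        using dim C(4) vs.basis_card_eq_dim[OF D(2,4,3)] by simp
      then have "C = D" using card_seteq[OF fin_indep[OF D(2,3)] D(1)] by simp
      then have "M \<subseteq> N" using D(4) C(1) N_sub vs.span_minimal by blast
      have "v \<in> W" if v: "v \<in> carrier_vec n" for v
      proof -
        have "val v \<in> N" using comb \<open>M \<subseteq> N\<close> by (auto simp: val_def)
        then obtain w where "w \<in> W" "val v = val w" by (auto simp: N_def)
        then show ?thesis using val_inj[of v w] v W(1) by blast
      qed
      then show ?thesis using W(1) by blast
    qed
  qed
  ultimately have "irreducible_rep G n \<rho>"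
    using rep by (auto simp: irreducible_rep_def)
  then show ?thesis using that[of n \<rho> b] bL indep \<rho>_act by blast
qed

section \<open>The group algebra of a subgroup inside that of the group\<close>

lemma (in ring) diff_mult_distrib:
  assumes "a \<in> carrier R" "b \<in> carrier R" "c \<in> carrier R"
  shows "(a \<ominus> b) \<otimes> c = a \<otimes> c \<ominus> b \<otimes> c" "c \<otimes> (a \<ominus> b) = c \<otimes> a \<ominus> c \<otimes> b"
  using assms by (auto simp: a_minus_def l_distr r_distr l_minus r_minus)

lemma (in ring) diff_zero: "a \<in> carrier R \<Longrightarrow> a \<ominus> \<zero> = a"
  by (simp add: a_minus_def)

locale finite_group_with_subgroup = group G + H: subgroup H G
  for G (structure) and H +
  assumes finite_carrier: "finite (carrier G)"
begin

abbreviation A where "A \<equiv> group_algebra G"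
abbreviation K where "K \<equiv> G\<lparr>carrier := H\<rparr>"
abbreviation B where "B \<equiv> carrier (group_algebra K)"
abbreviation conv (infixl "\<star>" 70) where "f \<star> g \<equiv> f \<otimes>\<^bsub>A\<^esub> g"
abbreviation \<eta> where "\<eta> \<equiv> eta H"

sublocale A: ring A
  by (rule group_algebra_ring) (use is_group finite_carrier in auto)

sublocale K: group K
  by (rule H.subgroup_is_group) (rule is_group)

lemma subgroup_H: "subgroup H G" by (rule H.subgroup_axioms)

lemma finite_H: "finite H" using H.subset finite_carrier by (rule finite_subset)

lemma card_H: "card H > 0" using finite_H H.one_closed unfolding card_gt_0_iff by blast

lemma inv_K: "h \<in> H \<Longrightarrow> inv\<^bsub>K\<^esub> h = inv h"
  using subgroup_H by (rule m_inv_consistent)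

lemma B_iff: "f \<in> B \<longleftrightarrow> (\<forall>x. x \<notin> H \<longrightarrow> f x = 0)"
  by (simp add: group_algebra_simps)

lemma B_subset: "f \<in> B \<Longrightarrow> f \<in> carrier A"
  using H.subset by (auto simp: group_algebra_simps)

lemma conv_outside: "x \<notin> carrier G \<Longrightarrow> (f \<star> g) x = 0"
  by (simp add: group_algebra_simps)

lemma conv_left: "x \<in> carrier G \<Longrightarrow> (f \<star> g) x = (\<Sum>y\<in>carrier G. f y * g (inv y \<otimes> x))"
  by (simp add: group_algebra_simps)

lemma conv_right: "x \<in> carrier G \<Longrightarrow> (f \<star> g) x = (\<Sum>u\<in>carrier G. f (x \<otimes> inv u) * g u)"
  unfolding conv_left
  by (intro sum.reindex_bij_witness[where i = "\<lambda>u. x \<otimes> inv u" and j = "\<lambda>y. inv y \<otimes> x"])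
    (auto simp: m_assoc[symmetric] inv_mult_group, auto simp: m_assoc)

lemma conv_closed: "f \<star> g \<in> carrier A"
  by (simp add: group_algebra_simps)

lemma group_algebra_eqI:
  assumes "f \<in> carrier A" "g \<in> carrier A" "\<And>x. x \<in> carrier G \<Longrightarrow> f x = g x"
  shows "f = g"
proof
  fix x show "f x = g x"
    using assms by (cases "x \<in> carrier G") (simp_all add: group_algebra_simps(1))
qed

lemma B_conv_closed:
  assumes "f \<in> B" "g \<in> B"
  shows "f \<star> g \<in> B"
  unfolding B_iff
proof (intro allI impI)
  fix x assume x: "x \<notin> H"
  have "f y * g (inv y \<otimes> x) = 0" if y: "y \<in> carrier G" "x \<in> carrier G" for y
  proof (rule ccontr)
    assume "f y * g (inv y \<otimes> x) \<noteq> 0"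
    then have "y \<in> H" "inv y \<otimes> x \<in> H" using assms by (auto simp: B_iff)
    then have "y \<otimes> (inv y \<otimes> x) \<in> H" by blast
    then show False using x y by (simp add: m_assoc[symmetric])
  qed
  then show "(f \<star> g) x = 0" by (cases "x \<in> carrier G") (simp_all add: conv_left conv_outside)
qed

lemma conv_scale_left: "(\<lambda>x. c * f x) \<star> g = (\<lambda>x. c * (f \<star> g) x)"
  by (simp add: group_algebra_simps fun_eq_iff sum_distrib_left mult.assoc)

lemma conv_scale_right: "f \<star> (\<lambda>x. c * g x) = (\<lambda>x. c * (f \<star> g) x)"
  by (simp add: group_algebra_simps fun_eq_iff sum_distrib_left mult.left_commute)

definition ind :: "'a set \<Rightarrow> 'a \<Rightarrow> complex" where
  "ind S = (\<lambda>x. if x \<in> S then 1 else 0)"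

lemma ind_in_A: "S \<subseteq> carrier G \<Longrightarrow> ind S \<in> carrier A"
  by (auto simp: group_algebra_simps ind_def)

lemma ind_in_B: "S \<subseteq> H \<Longrightarrow> ind S \<in> B"
  by (auto simp: B_iff ind_def)

lemma conv_ind_right:
  assumes "S \<subseteq> carrier G" "x \<in> carrier G"
  shows "(f \<star> ind S) x = (\<Sum>k\<in>S. f (x \<otimes> inv k))"
proof -
  have "(f \<star> ind S) x = (\<Sum>u\<in>carrier G. if u \<in> S then f (x \<otimes> inv u) else 0)"
    using assms(2) unfolding conv_right[OF assms(2)] by (intro sum.cong) (auto simp: ind_def)
  then show ?thesis using assms finite_carrier by (simp add: sum.If_cases Int_absorb1)
qed

lemma conv_ind_left:
  assumes "S \<subseteq> carrier G" "x \<in> carrier G"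
  shows "(ind S \<star> f) x = (\<Sum>k\<in>S. f (inv k \<otimes> x))"
proof -
  have "(ind S \<star> f) x = (\<Sum>u\<in>carrier G. if u \<in> S then f (inv u \<otimes> x) else 0)"
    using assms(2) unfolding conv_left[OF assms(2)] by (intro sum.cong) (auto simp: ind_def)
  then show ?thesis using assms finite_carrier by (simp add: sum.If_cases Int_absorb1)
qed

lemma eta_ind: "\<eta> = (\<lambda>x. (1 / of_nat (card H)) * ind H x)"
  by (simp add: eta_def ind_def fun_eq_iff)

lemma eta_in_B: "\<eta> \<in> B"
  by (simp add: B_iff eta_def)

lemma conv_eta:
  "x \<in> carrier G \<Longrightarrow> (f \<star> \<eta>) x = (\<Sum>k\<in>H. f (x \<otimes> inv k)) / of_nat (card H)"
  unfolding eta_ind conv_scale_right by (simp add: conv_ind_right H.subset)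

lemma eta_conv:
  "x \<in> carrier G \<Longrightarrow> (\<eta> \<star> f) x = (\<Sum>k\<in>H. f (inv k \<otimes> x)) / of_nat (card H)"
  unfolding eta_ind conv_scale_left by (simp add: conv_ind_left H.subset)

text \<open>Both products are \<open>\<eta>\<close> times the sum of the coefficients of \<open>b\<close>.\<close>

lemma eta_central:
  assumes b: "b \<in> B"
  shows "\<eta> \<star> b = b \<star> \<eta>"
proof (rule group_algebra_eqI[OF conv_closed conv_closed])
  fix x assume x: "x \<in> carrier G"
  show "(\<eta> \<star> b) x = (b \<star> \<eta>) x"
  proof (cases "x \<in> H")
    case True
    have "(\<Sum>k\<in>H. b (inv k \<otimes> x)) = (\<Sum>k\<in>H. b (x \<otimes> inv k))"
      using True
      by (intro sum.reindex_bij_witness[where i = "\<lambda>k. x \<otimes> k \<otimes> inv x"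
            and j = "\<lambda>k. inv x \<otimes> k \<otimes> x"])
        (auto simp: inv_mult_group m_assoc, auto simp: m_assoc[symmetric])
    then show ?thesis using x by (simp add: eta_conv conv_eta)
  next
    case False
    moreover have "\<eta> \<star> b \<in> B" "b \<star> \<eta> \<in> B" using b eta_in_B by (auto intro: B_conv_closed)
    ultimately show ?thesis by (simp add: B_iff)
  qed
qed

lemma eta_idem: "\<eta> \<star> \<eta> = \<eta>"
proof (rule group_algebra_eqI[OF conv_closed B_subset[OF eta_in_B]])
  fix x assume x: "x \<in> carrier G"
  show "(\<eta> \<star> \<eta>) x = \<eta> x"
  proof (cases "x \<in> H")
    case True
    then have "(\<Sum>k\<in>H. \<eta> (inv k \<otimes> x)) = (\<Sum>k\<in>H. 1 / of_nat (card H))"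
      by (intro sum.cong) (auto simp: eta_def)
    then show ?thesis using True x card_H by (simp add: eta_conv) (simp add: eta_def)
  next
    case False
    then show ?thesis using B_conv_closed[OF eta_in_B eta_in_B] by (simp add: B_iff eta_def)
  qed
qed

section \<open>The annihilator of the permutation module\<close>

text \<open>This is \<open>H \<inter> x H x\<inverse>\<close>, the stabiliser in \<open>H\<close> of the coset \<open>xH\<close>.\<close>

definition stab :: "'a \<Rightarrow> 'a set" where
  "stab x = {h \<in> H. inv x \<otimes> h \<otimes> x \<in> H}"

lemma stab_subset: "stab x \<subseteq> H" "stab x \<subseteq> carrier G"
  using H.subset by (auto simp: stab_def)

lemma stab_subgroup:
  assumes x: "x \<in> carrier G"
  shows "subgroup (stab x) K"
proof (rule K.subgroupI)
  show "stab x \<noteq> {}" using x by (auto simp: stab_def intro!: exI[of _ \<one>])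
  fix a assume a: "a \<in> stab x"
  then have aG: "a \<in> carrier G" using stab_subset by auto
  from a have "inv (inv x \<otimes> a \<otimes> x) \<in> H" by (auto simp: stab_def)
  also have "inv (inv x \<otimes> a \<otimes> x) = inv x \<otimes> inv a \<otimes> x"
    using aG x by (simp add: inv_mult_group m_assoc)
  finally show "inv\<^bsub>K\<^esub> a \<in> stab x" using a by (auto simp: stab_def inv_K)
  fix b assume b: "b \<in> stab x"
  have "(inv x \<otimes> a \<otimes> x) \<otimes> (inv x \<otimes> b \<otimes> x) \<in> H" using a b by (auto simp: stab_def)
  also have "(inv x \<otimes> a \<otimes> x) \<otimes> (inv x \<otimes> b \<otimes> x) = inv x \<otimes> (a \<otimes> (x \<otimes> inv x) \<otimes> b) \<otimes> x"
    using a b x stab_subset[of x] by (simp only: m_assoc m_closed inv_closed subsetD)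
  also have "\<dots> = inv x \<otimes> (a \<otimes> b) \<otimes> x" using a b x stab_subset[of x] by (simp add: subsetD)
  finally show "a \<otimes>\<^bsub>K\<^esub> b \<in> stab x" using a b by (auto simp: stab_def)
qed (use stab_subset in auto)

text \<open>The element \<open>x \<eta> x\<inverse>\<close> is the uniform average over \<open>x H x\<inverse>\<close>. Multiplying \<open>b \<in> \<complex>[H]\<close> by it and reading off
coefficients in \<open>H\<close> only sees the part \<open>H \<inter> x H x\<inverse>\<close> of the support.\<close>

lemma conv_delta_eta:
  assumes b: "b \<in> B" and x: "x \<in> carrier G" and y: "y \<in> H"
  shows "(b \<star> ind {x} \<star> \<eta>) (y \<otimes> x) = (b \<star> ind (stab x)) y / of_nat (card H)"
proof -
  have "(b \<star> ind {x} \<star> \<eta>) (y \<otimes> x) = (\<Sum>k\<in>H. b (y \<otimes> (x \<otimes> inv k \<otimes> inv x))) / of_nat (card H)"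
    using x y by (simp add: conv_eta conv_ind_right m_assoc)
  also have "(\<Sum>k\<in>H. b (y \<otimes> (x \<otimes> inv k \<otimes> inv x))) =
      (\<Sum>k | k \<in> H \<and> x \<otimes> k \<otimes> inv x \<in> H. b (y \<otimes> (x \<otimes> inv k \<otimes> inv x)))"
  proof (rule sum.mono_neutral_right)
    show "\<forall>k\<in>H - {k \<in> H. x \<otimes> k \<otimes> inv x \<in> H}. b (y \<otimes> (x \<otimes> inv k \<otimes> inv x)) = 0"
    proof
      fix k assume k: "k \<in> H - {k \<in> H. x \<otimes> k \<otimes> inv x \<in> H}"
      have "y \<otimes> (x \<otimes> inv k \<otimes> inv x) \<notin> H"
      proof
        assume "y \<otimes> (x \<otimes> inv k \<otimes> inv x) \<in> H"
        then have "inv (inv y \<otimes> (y \<otimes> (x \<otimes> inv k \<otimes> inv x))) \<in> H" using y by blast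
        also have "inv (inv y \<otimes> (y \<otimes> (x \<otimes> inv k \<otimes> inv x))) = x \<otimes> k \<otimes> inv x"
          using x y k by (simp add: m_assoc[symmetric]) (simp add: inv_mult_group m_assoc)
        finally show False using k by auto
      qed
      then show "b (y \<otimes> (x \<otimes> inv k \<otimes> inv x)) = 0" using b by (simp add: B_iff)
    qed
  qed (use finite_H in auto)
  also have "\<dots> = (\<Sum>k\<in>stab x. b (y \<otimes> inv k))"
    using x y
    by (intro sum.reindex_bij_witness[where i = "\<lambda>s. inv x \<otimes> s \<otimes> x"
          and j = "\<lambda>k. x \<otimes> k \<otimes> inv x"])
      (auto simp: stab_def inv_mult_group m_assoc, auto simp: m_assoc[symmetric])
  finally show ?thesis using x y stab_subset by (simp add: conv_ind_right)
qed

text \<open>The module \<open>\<complex>[G]\<eta>\<close> is spanned by the elements \<open>x \<eta>\<close>, and \<open>b x \<eta>\<close> lives on the double coset \<open>H x H\<close>. On the points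
\<open>y x\<close> with \<open>y \<in> H\<close> it agrees with the product of \<open>b\<close> and the sum of the stabiliser, up to scaling, and
these points represent all cosets \<open>g H\<close> in the double coset. This replaces a condition in \<open>\<complex>[G]\<close> by
conditions inside \<open>\<complex>[H]\<close>.\<close>

lemma annihilates_iff:
  assumes b: "b \<in> B"
  shows "(\<forall>w\<in>carrier A. b \<star> w \<star> \<eta> = \<zero>\<^bsub>A\<^esub>) \<longleftrightarrow> (\<forall>x\<in>carrier G. b \<star> ind (stab x) = \<zero>\<^bsub>A\<^esub>)"
proof (intro iffI ballI)
  fix x assume L: "\<forall>w\<in>carrier A. b \<star> w \<star> \<eta> = \<zero>\<^bsub>A\<^esub>" and x: "x \<in> carrier G"
  have B: "b \<star> ind (stab x) \<in> B" using b by (intro B_conv_closed ind_in_B stab_subset)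
  show "b \<star> ind (stab x) = \<zero>\<^bsub>A\<^esub>"
  proof (rule group_algebra_eqI[OF conv_closed A.zero_closed])
    fix y assume "y \<in> carrier G"
    show "(b \<star> ind (stab x)) y = \<zero>\<^bsub>A\<^esub> y"
    proof (cases "y \<in> H")
      case True
      have "b \<star> ind {x} \<star> \<eta> = \<zero>\<^bsub>A\<^esub>" using L x by (simp add: ind_in_A)
      then show ?thesis
        using conv_delta_eta[OF b x True] card_H by (simp add: group_algebra_simps(4))
    next
      case False
      then show ?thesis using B by (simp add: B_iff group_algebra_simps(4))
    qed
  qed
next
  fix w assume R: "\<forall>x\<in>carrier G. b \<star> ind (stab x) = \<zero>\<^bsub>A\<^esub>" and w: "w \<in> carrier A"
  have delta: "(\<Sum>k\<in>H. b (g \<otimes> inv k \<otimes> inv u)) = 0"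
    if g: "g \<in> carrier G" and u: "u \<in> carrier G" for g u
  proof (cases "\<exists>k\<in>H. g \<otimes> inv k \<otimes> inv u \<in> H")
    case False
    then show ?thesis using b by (intro sum.neutral) (auto simp: B_iff)
  next
    case True
    then obtain k where k: "k \<in> H" and y: "g \<otimes> inv k \<otimes> inv u \<in> H" by blast
    \<comment> \<open>\<open>g = ?y \<otimes> u \<otimes> k\<close>, and the sum depends on \<open>g\<close> only through the coset \<open>g H\<close>\<close>
    let ?y = "g \<otimes> inv k \<otimes> inv u"
    have "(\<Sum>l\<in>H. b (g \<otimes> inv l \<otimes> inv u)) = (\<Sum>l\<in>H. b (?y \<otimes> u \<otimes> inv l \<otimes> inv u))"
      using g u k
      by (intro sum.reindex_bij_witness[where i = "\<lambda>l. l \<otimes> k" and j = "\<lambda>l. l \<otimes> inv k"])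
        (auto simp: inv_mult_group m_assoc, auto simp: m_assoc[symmetric])
    also have "\<dots> = of_nat (card H) * (b \<star> ind {u} \<star> \<eta>) (?y \<otimes> u)"
      using g u k card_H by (simp add: conv_eta conv_ind_right)
    also have "\<dots> = 0"
      using R u card_H by (simp add: conv_delta_eta[OF b u y] group_algebra_simps(4))
    finally show ?thesis .
  qed
  show "b \<star> w \<star> \<eta> = \<zero>\<^bsub>A\<^esub>"
  proof (rule group_algebra_eqI[OF conv_closed A.zero_closed])
    fix g assume g: "g \<in> carrier G"
    have "(\<Sum>k\<in>H. (b \<star> w) (g \<otimes> inv k)) = (\<Sum>u\<in>carrier G. (\<Sum>k\<in>H. b (g \<otimes> inv k \<otimes> inv u)) * w u)"
      using g by (simp add: conv_right sum_distrib_right) (rule sum.swap)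
    also have "\<dots> = 0" using g by (simp add: delta)
    finally show "(b \<star> w \<star> \<eta>) g = \<zero>\<^bsub>A\<^esub> g"
      using g by (simp add: conv_eta group_algebra_simps(4))
  qed
qed

section \<open>The positive involution of the group algebra\<close>

definition star :: "('a \<Rightarrow> complex) \<Rightarrow> 'a \<Rightarrow> complex" where
  "star f = (\<lambda>x. if x \<in> carrier G then cnj (f (inv x)) else 0)"

lemma star_in_A: "star f \<in> carrier A"
  by (simp add: star_def group_algebra_simps)

lemma star_in_B:
  assumes "f \<in> B"
  shows "star f \<in> B"
proof -
  have "inv x \<notin> H" if "x \<in> carrier G" "x \<notin> H" for x
    using that H.m_inv_closed[of "inv x"] by auto
  then show ?thesis using assms by (auto simp: B_iff star_def)
qed

lemma star_star: "f \<in> carrier A \<Longrightarrow> star (star f) = f"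
  by (auto simp: star_def group_algebra_simps)

lemma star_conv: "star (f \<star> g) = star g \<star> star f"
proof (rule group_algebra_eqI[OF star_in_A conv_closed])
  fix x assume x: "x \<in> carrier G"
  have "star (f \<star> g) x = (\<Sum>y\<in>carrier G. cnj (f y) * cnj (g (inv y \<otimes> inv x)))"
    using x by (simp add: star_def conv_left)
  also have "\<dots> = (\<Sum>u\<in>carrier G. cnj (g (u \<otimes> inv x)) * cnj (f (inv u)))"
    using x by (intro sum.reindex_bij_witness[where i = "\<lambda>u. inv u" and j = "\<lambda>u. inv u"]) auto
  also have "\<dots> = (star g \<star> star f) x"
    using x unfolding conv_right[OF x] by (intro sum.cong) (auto simp: star_def inv_mult_group)
  finally show "star (f \<star> g) x = (star g \<star> star f) x" .
qed

lemma star_zero: "star \<zero>\<^bsub>A\<^esub> = \<zero>\<^bsub>A\<^esub>"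
  by (simp add: star_def group_algebra_simps fun_eq_iff)

lemma star_ind:
  assumes "S \<subseteq> carrier G" and "\<And>x. x \<in> S \<Longrightarrow> inv x \<in> S"
  shows "star (ind S) = ind S"
proof -
  have "inv x \<in> S \<longleftrightarrow> x \<in> S" if "x \<in> carrier G" for x
    using that assms(2)[of x] assms(2)[of "inv x"] by auto
  then show ?thesis using assms(1) by (auto simp: star_def ind_def fun_eq_iff)
qed

lemma star_eta: "star \<eta> = \<eta>"
proof -
  have "star (ind H) = ind H" by (rule star_ind) (use H.subset in auto)
  moreover have "star \<eta> = (\<lambda>x. (1 / of_nat (card H)) * star (ind H) x)"
    by (simp add: eta_ind star_def fun_eq_iff)
  ultimately show ?thesis by (simp add: eta_ind)
qed

text \<open>The coefficient of \<open>f \<star> star f\<close> at the identity is the sum of all \<open>\<bar>f y\<bar>\<^sup>2\<close>.\<close>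

lemma conv_star_eq_zero:
  assumes f: "f \<in> carrier A" and zero: "f \<star> star f = \<zero>\<^bsub>A\<^esub>"
  shows "f = \<zero>\<^bsub>A\<^esub>"
proof (rule group_algebra_eqI[OF f A.zero_closed])
  have "(\<Sum>y\<in>carrier G. f y * cnj (f y)) = (f \<star> star f) \<one>"
    by (simp add: conv_left star_def)
  also have "\<dots> = 0" by (simp add: zero group_algebra_simps(4))
  finally have "complex_of_real (\<Sum>y\<in>carrier G. (cmod (f y))\<^sup>2) = 0"
    by (simp add: complex_norm_square[symmetric])
  then have "(\<Sum>y\<in>carrier G. (cmod (f y))\<^sup>2) = 0" by (simp only: of_real_eq_0_iff)
  then show "f x = \<zero>\<^bsub>A\<^esub> x" if "x \<in> carrier G" for x
    using that finite_carrier by (simp add: sum_nonneg_eq_0_iff group_algebra_simps(4))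
qed

section \<open>Full induction restriction as faithfulness\<close>

text \<open>Exchange the two sums: the pair \<open>(h, x)\<close> contributes when \<open>h\<close> fixes the coset \<open>xH\<close>, which is \<open>h \<in> stab x\<close>. One
factor \<open>card H\<close> comes from the inner product, the other one from counting group elements instead of cosets.\<close>

lemma char_inner_permutation:
  "char_inner K \<chi> (restrict (induced_char G H (\<lambda>h\<in>H. 1)) H) =
    (\<Sum>x\<in>carrier G. \<Sum>k\<in>stab x. \<chi> k) / (of_nat (card H))\<^sup>2"
proof -
  have perm: "induced_char G H (\<lambda>h\<in>H. 1) h =
      (\<Sum>x\<in>carrier G. if inv x \<otimes> h \<otimes> x \<in> H then 1 else 0) / of_nat (card H)" if "h \<in> H" for h
    using that finite_carrier H.subset
    by (auto simp: induced_char_def sum.inter_filter[symmetric])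
  have "char_inner K \<chi> (restrict (induced_char G H (\<lambda>h\<in>H. 1)) H) =
      (\<Sum>h\<in>H. \<Sum>x\<in>carrier G. if inv x \<otimes> h \<otimes> x \<in> H then \<chi> h else 0) / (of_nat (card H))\<^sup>2"
    by (simp add: char_inner_def perm sum_distrib_left sum_divide_distrib power2_eq_square
        if_distrib[of cnj] if_distrib[of "\<lambda>z. _ * z"] if_distrib[of "\<lambda>z. z / _"] cong: if_cong)
  also have "(\<Sum>h\<in>H. \<Sum>x\<in>carrier G. if inv x \<otimes> h \<otimes> x \<in> H then \<chi> h else 0) =
      (\<Sum>x\<in>carrier G. \<Sum>k\<in>stab x. \<chi> k)"
    by (subst sum.swap) (simp add: stab_def sum.inter_filter[OF finite_H])
  finally show ?thesis .
qed

lemma ind_sum_action: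
  "S \<subseteq> carrier G \<Longrightarrow> ind S \<star> f = (\<lambda>x. \<Sum>k\<in>S. (ind {k} \<star> f) x)"
proof
  fix x assume S: "S \<subseteq> carrier G"
  show "(ind S \<star> f) x = (\<Sum>k\<in>S. (ind {k} \<star> f) x)"
  proof (cases "x \<in> carrier G")
    case True
    then have "(ind {k} \<star> f) x = f (inv k \<otimes> x)" if "k \<in> S" for k
      using that S by (subst conv_ind_left) auto
    then show ?thesis using S True by (simp add: conv_ind_left)
  qed (simp add: conv_outside)
qed

lemma ind_mult:
  assumes "g \<in> carrier G" "h \<in> carrier G"
  shows "ind {g \<otimes> h} = ind {g} \<star> ind {h}"
proof (rule group_algebra_eqI[OF _ conv_closed])
  fix x assume x: "x \<in> carrier G"
  have "x \<otimes> inv h = g \<longleftrightarrow> x = g \<otimes> h" using x assms by (auto simp: m_assoc)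
  then show "ind {g \<otimes> h} x = (ind {g} \<star> ind {h}) x"
    using x assms by (simp add: conv_ind_right) (simp add: ind_def)
qed (use assms in \<open>simp add: ind_in_A\<close>)

lemma ind_one: "ind {\<one>} = \<one>\<^bsub>A\<^esub>"
  by (simp add: ind_def group_algebra_simps(3))

lemma sum_fun_apply: "(\<Sum>i\<in>I. f i) x = (\<Sum>i\<in>I. f i x)"
  for f :: "'i \<Rightarrow> 'c \<Rightarrow> complex"
  by (induction I rule: infinite_finite_induct) simp_all

text \<open>Let \<open>J\<close> be the annihilator of \<open>\<complex>[G]\<eta>\<close> in \<open>\<complex>[H]\<close>, a two-sided ideal, and suppose that it is nonzero. An
irreducible character afforded by a submodule of \<open>J\<close> has nonzero inner product with the permutation character,
so some stabiliser sum \<open>\<kappa>\<close> and some \<open>u \<in> J\<close> have \<open>\<kappa> u \<noteq> 0\<close>. But \<open>u u\<^sup>* \<in> J\<close> gives \<open>u u\<^sup>* \<kappa> = 0\<close>, and as \<open>\<kappa>\<close> is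
self-adjoint, \<open>(\<kappa> u)(\<kappa> u)\<^sup>* = \<kappa> u u\<^sup>* \<kappa> = 0\<close>, whence \<open>\<kappa> u = 0\<close>.\<close>

lemma faithful_if_full:
  assumes full: "full_induction_restriction G H"
    and b: "b \<in> B" and annih: "\<And>w. w \<in> carrier A \<Longrightarrow> b \<star> w \<star> \<eta> = \<zero>\<^bsub>A\<^esub>"
  shows "b = \<zero>\<^bsub>A\<^esub>"
proof (rule ccontr)
  assume nz: "b \<noteq> \<zero>\<^bsub>A\<^esub>"
  define scale :: "complex \<Rightarrow> ('a \<Rightarrow> complex) \<Rightarrow> 'a \<Rightarrow> complex" where
    "scale c f = (\<lambda>x. c * f x)" for c f
  have vs: "vector_space scale"
    by unfold_locales (auto simp: scale_def fun_eq_iff algebra_simps)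
  interpret vs: vector_space scale by (rule vs)
  have zero: "0 = \<zero>\<^bsub>A\<^esub>" by (simp add: group_algebra_simps(4) fun_eq_iff)
  have add: "f + g = f \<oplus>\<^bsub>A\<^esub> g" for f g
    by (simp add: group_algebra_simps(5) fun_eq_iff)
  have scale_left: "scale c f \<star> g = scale c (f \<star> g)" for c f g
    unfolding scale_def by (rule conv_scale_left)
  have scale_right: "f \<star> scale c g = scale c (f \<star> g)" for c f g
    unfolding scale_def by (rule conv_scale_right)
  define J where "J = {f \<in> B. \<forall>w\<in>carrier A. f \<star> w \<star> \<eta> = \<zero>\<^bsub>A\<^esub>}"
  have JA: "f \<in> carrier A" if "f \<in> J" for f using that B_subset by (auto simp: J_def)
  have etaA: "\<eta> \<in> carrier A" using eta_in_B B_subset by blast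
  have J_sub: "vs.subspace J"
  proof (rule vs.subspaceI)
    show "0 \<in> J" using etaA by (simp add: J_def zero) (simp add: B_iff group_algebra_simps(4))
    show "f + g \<in> J" if "f \<in> J" "g \<in> J" for f g
    proof -
      have "f + g \<in> B" using that by (simp add: J_def B_iff)
      then show ?thesis using that JA[OF that(1)] JA[OF that(2)] etaA
        by (simp add: J_def add A.l_distr)
    qed
    show "scale c f \<in> J" if "f \<in> J" for c f
    proof -
      have "scale c f \<in> B" using that by (simp add: J_def B_iff scale_def)
      then show ?thesis using that by (simp add: J_def scale_left) (simp add: zero[symmetric])
    qed
  qed
  have J_span: "J \<subseteq> vs.span ((\<lambda>h. ind {h}) ` H)"
  proof
    fix f assume "f \<in> J"
    then have f: "f \<in> B" by (simp add: J_def)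
    have "(\<Sum>h\<in>H. scale (f h) (ind {h})) = f"
    proof
      fix x
      have "(\<Sum>h\<in>H. scale (f h) (ind {h})) x = (\<Sum>h\<in>H. if h = x then f x else 0)"
        unfolding sum_fun_apply by (intro sum.cong) (auto simp: scale_def ind_def)
      then show "(\<Sum>h\<in>H. scale (f h) (ind {h})) x = f x"
        using f finite_H by (simp add: B_iff)
    qed
    moreover have "(\<Sum>h\<in>H. scale (f h) (ind {h})) \<in> vs.span ((\<lambda>h. ind {h}) ` H)"
      by (intro vs.span_sum vs.span_scale vs.span_base) auto
    ultimately show "f \<in> vs.span ((\<lambda>h. ind {h}) ` H)" by simp
  qed
  have bJ: "b \<in> J" using b annih by (simp add: J_def)
  have J_act: "ind {k} \<star> f \<in> J" if k: "k \<in> H" and f: "f \<in> J" for k f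
  proof -
    have "ind {k} \<in> B" using k by (intro ind_in_B) auto
    moreover from this have "ind {k} \<in> carrier A" by (rule B_subset)
    ultimately show ?thesis
      using f JA[OF f] etaA by (auto simp: J_def A.m_assoc intro!: B_conv_closed)
  qed
  have J_nz: "J \<noteq> {0}" using bJ nz zero by auto
  have fin: "finite ((\<lambda>h. ind {h}) ` H)" using finite_H by simp
  have indA: "ind {k} \<in> carrier A" if "k \<in> H" for k using that H.subset by (intro ind_in_A) auto
  have act_in: "ind {g} \<star> f \<in> J" if "g \<in> carrier K" "f \<in> J" for g f
    using that J_act by simp
  have act_add: "ind {g} \<star> (f + f') = ind {g} \<star> f + ind {g} \<star> f'"
    if "g \<in> carrier K" "f \<in> J" "f' \<in> J" for g f f'
    using that by (simp add: add A.r_distr indA JA)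
  have act_scale: "ind {g} \<star> scale c f = scale c (ind {g} \<star> f)"
    if "g \<in> carrier K" "f \<in> J" for g c f
    by (rule scale_right)
  have act_mult: "ind {g \<otimes>\<^bsub>K\<^esub> h} \<star> f = ind {g} \<star> (ind {h} \<star> f)"
    if "g \<in> carrier K" "h \<in> carrier K" "f \<in> J" for g h f
    using that by (simp add: ind_mult A.m_assoc indA JA)
  have act_one: "ind {\<one>\<^bsub>K\<^esub>} \<star> f = f" if "f \<in> J" for f
    using that by (simp add: ind_one JA)
  obtain n \<rho> v where irr: "irreducible_rep K n \<rho>" and v: "\<And>j. j < n \<Longrightarrow> v j \<in> J"
    and indep: "\<And>c. (\<Sum>j<n. scale (c j) (v j)) = 0 \<Longrightarrow> \<forall>j<n. c j = 0"
    and act_v: "\<And>g j. g \<in> carrier K \<Longrightarrow> j < n \<Longrightarrow>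
      ind {g} \<star> v j = (\<Sum>i<n. scale (\<rho> g $$ (i, j)) (v i))"
  proof (rule K.irreducible_constituent[OF vs J_sub J_span fin J_nz
        act_in act_add act_scale act_mult act_one])
    fix n \<rho> b
    assume *: "irreducible_rep K n \<rho>" "\<And>j. j < n \<Longrightarrow> b j \<in> J"
      "\<And>c. (\<Sum>j<n. scale (c j) (b j)) = 0 \<Longrightarrow> \<forall>j<n. c j = 0"
      "\<And>g j. g \<in> carrier K \<Longrightarrow> j < n \<Longrightarrow>
        ind {g} \<star> b j = (\<Sum>i<n. scale (\<rho> g $$ (i, j)) (b i))"
    show thesis by (rule that[OF *])
  qed
  define \<chi> where "\<chi> = restrict (\<lambda>g. \<Sum>i<n. \<rho> g $$ (i, i)) (carrier K)"
  have "\<chi> \<in> irreducible_characters K"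
    using irr by (auto simp: irreducible_characters_def \<chi>_def)
  then have "(\<Sum>x\<in>carrier G. \<Sum>k\<in>stab x. \<chi> k) \<noteq> 0"
    using full by (auto simp: full_induction_restriction_def char_inner_permutation)
  then obtain x where x: "x \<in> carrier G" and sum: "(\<Sum>k\<in>stab x. \<chi> k) \<noteq> 0"
    by (meson sum.neutral)
  have "(\<Sum>k\<in>stab x. \<chi> k) = (\<Sum>i<n. \<Sum>k\<in>stab x. \<rho> k $$ (i, i))"
    by (subst sum.swap, intro sum.cong) (use stab_subset in \<open>auto simp: \<chi>_def\<close>)
  with sum obtain i where i: "i < n" and entry: "(\<Sum>k\<in>stab x. \<rho> k $$ (i, i)) \<noteq> 0"
    by (metis (no_types, lifting) lessThan_iff sum.neutral)
  define \<kappa> where "\<kappa> = ind (stab x)"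
  have \<kappa>B: "\<kappa> \<in> B" unfolding \<kappa>_def by (intro ind_in_B stab_subset)
  have \<kappa>A: "\<kappa> \<in> carrier A" using \<kappa>B by (rule B_subset)
  have star_\<kappa>: "star \<kappa> = \<kappa>"
    unfolding \<kappa>_def
  proof (rule star_ind[OF stab_subset(2)])
    fix y assume y: "y \<in> stab x"
    then have "inv\<^bsub>K\<^esub> y \<in> stab x" using subgroup.m_inv_closed[OF stab_subgroup[OF x]] by blast
    moreover have "y \<in> H" using y stab_subset by blast
    ultimately show "inv y \<in> stab x" by (simp add: inv_K)
  qed
  let ?u = "v i"
  have uJ: "?u \<in> J" by (rule v[OF i])
  have uA: "?u \<in> carrier A" by (rule JA[OF uJ])
  have uB: "?u \<in> B" using uJ unfolding J_def by blast
  have u_annih: "?u \<star> w \<star> \<eta> = \<zero>\<^bsub>A\<^esub>" if "w \<in> carrier A" for w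
    using uJ that unfolding J_def by blast
  \<comment> \<open>the nonzero entry is a coordinate of \<open>\<kappa> \<star> ?u\<close> in the independent family \<open>v\<close>\<close>
  have "\<kappa> \<star> ?u \<noteq> \<zero>\<^bsub>A\<^esub>"
  proof
    assume "\<kappa> \<star> ?u = \<zero>\<^bsub>A\<^esub>"
    have "(\<Sum>j<n. scale (\<Sum>k\<in>stab x. \<rho> k $$ (j, i)) (v j)) = (\<Sum>k\<in>stab x. ind {k} \<star> ?u)"
    proof -
      have "(\<Sum>k\<in>stab x. ind {k} \<star> ?u) = (\<Sum>k\<in>stab x. \<Sum>j<n. scale (\<rho> k $$ (j, i)) (v j))"
        using i stab_subset by (intro sum.cong refl act_v) auto
      then show ?thesis by (simp add: vs.scale_sum_left) (rule sum.swap)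
    qed
    also have "\<dots> = \<kappa> \<star> ?u"
      unfolding \<kappa>_def ind_sum_action[OF stab_subset(2)] by (simp add: sum_fun_apply fun_eq_iff)
    also have "\<dots> = 0" using \<open>\<kappa> \<star> ?u = \<zero>\<^bsub>A\<^esub>\<close> by (simp only: zero)
    finally have "\<forall>j<n. (\<Sum>k\<in>stab x. \<rho> k $$ (j, i)) = 0" by (rule indep)
    then show False using i entry by blast
  qed
  moreover have "\<kappa> \<star> ?u = \<zero>\<^bsub>A\<^esub>"
  proof (rule conv_star_eq_zero[OF conv_closed])
    have uu: "?u \<star> star ?u \<in> B" using uB by (intro B_conv_closed star_in_B)
    have "?u \<star> star ?u \<star> w \<star> \<eta> = \<zero>\<^bsub>A\<^esub>" if "w \<in> carrier A" for w
      using u_annih[OF conv_closed] A.m_assoc[OF uA star_in_A that] by simp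
    then have "?u \<star> star ?u \<star> \<kappa> = \<zero>\<^bsub>A\<^esub>"
      using annihilates_iff[OF uu] x unfolding \<kappa>_def by blast
    moreover have "(\<kappa> \<star> ?u) \<star> star (\<kappa> \<star> ?u) = \<kappa> \<star> (?u \<star> star ?u \<star> \<kappa>)"
      unfolding star_conv star_\<kappa> using uA \<kappa>A star_in_A[of ?u] conv_closed by (simp add: A.m_assoc)
    ultimately show "(\<kappa> \<star> ?u) \<star> star (\<kappa> \<star> ?u) = \<zero>\<^bsub>A\<^esub>" using \<kappa>A by simp
  qed
  ultimately show False by contradiction
qed

lemma faithful_if_full_right:
  assumes full: "full_induction_restriction G H"
    and b: "b \<in> B" and annih: "\<And>w. w \<in> carrier A \<Longrightarrow> \<eta> \<star> w \<star> b = \<zero>\<^bsub>A\<^esub>"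
  shows "b = \<zero>\<^bsub>A\<^esub>"
proof -
  have "star b \<star> w \<star> \<eta> = \<zero>\<^bsub>A\<^esub>" if w: "w \<in> carrier A" for w
  proof -
    have "star (\<eta> \<star> star w \<star> b) = star b \<star> (w \<star> \<eta>)"
      unfolding star_conv star_eta star_star[OF w] ..
    then show ?thesis
      using annih[OF star_in_A] w B_subset[OF eta_in_B] star_in_A by (simp add: star_zero A.m_assoc)
  qed
  then have "star b = \<zero>\<^bsub>A\<^esub>" by (rule faithful_if_full[OF full star_in_B[OF b]])
  then have "star (star b) = \<zero>\<^bsub>A\<^esub>" by (simp add: star_zero)
  then show ?thesis using star_star B_subset b by simp
qed

text \<open>Let \<open>\<rho>\<close> be irreducible with character orthogonal to the permutation character. The orthogonality is a vanishing
sum of natural numbers \<open>card (stab x) * r x\<close>, so all \<open>r x\<close> are zero and \<open>\<rho>\<close> kills every stabiliser sum. The same then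
holds for right multiplication on any matrix coefficient of \<open>h \<mapsto> \<rho>(h\<inverse>)\<close>. The witness \<open>z\<close> is the diagonal
coefficient at position \<open>(0, 0)\<close>, scaled by \<open>n / card H\<close>, which by Schur orthogonality is the factor that makes it
idempotent.\<close>

lemma annihilating_idempotent:
  assumes "\<not> full_induction_restriction G H"
  obtains z where "z \<in> B" "z \<star> z = z" "z \<noteq> \<zero>\<^bsub>A\<^esub>"
    and "\<And>w. w \<in> carrier A \<Longrightarrow> z \<star> w \<star> \<eta> = \<zero>\<^bsub>A\<^esub>"
proof -
  from assms obtain \<chi> where "\<chi> \<in> irreducible_characters K"
    and inner: "char_inner K \<chi> (restrict (induced_char G H (\<lambda>h\<in>H. 1)) H) = 0"
    unfolding full_induction_restriction_def by blast
  then obtain n \<rho> where irr: "irreducible_rep K n \<rho>"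
    and \<chi>: "\<chi> = restrict (\<lambda>g. \<Sum>i<n. \<rho> g $$ (i, i)) (carrier K)"
    unfolding irreducible_characters_def by blast
  have sum: "(\<Sum>x\<in>carrier G. \<Sum>k\<in>stab x. \<chi> k) = 0"
    using inner card_H unfolding char_inner_permutation by simp
  have "(\<Sum>k\<in>stab x. \<chi> k) = (\<Sum>k\<in>stab x. \<Sum>i<n. \<rho> k $$ (i, i))" for x
    using stab_subset unfolding \<chi> by (intro sum.cong) auto
  with sum have total: "(\<Sum>x\<in>carrier G. \<Sum>k\<in>stab x. \<Sum>i<n. \<rho> k $$ (i, i)) = 0" by simp
  have rep: "matrix_rep K n \<rho>" and n: "n > 0" using irr by (auto simp: irreducible_rep_def)
  note mult = K.matrix_rep_mult_entry[OF rep, simplified]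
  have fin_stab: "finite (stab x)" for x using stab_subset finite_H finite_subset by blast
  have "\<forall>x\<in>carrier G. \<exists>r::nat.
      (\<Sum>k\<in>stab x. \<Sum>i<n. \<rho> k $$ (i, i)) = of_nat (card (stab x) * r) \<and>
      (r = 0 \<longrightarrow> (\<forall>i<n. \<forall>j<n. (\<Sum>k\<in>stab x. \<rho> k $$ (i, j)) = 0))"
  proof
    fix x assume x: "x \<in> carrier G"
    obtain r :: nat where "(\<Sum>k\<in>stab x. \<Sum>i<n. \<rho> k $$ (i, i)) = of_nat (card (stab x) * r)"
      and "\<And>i j. r = 0 \<Longrightarrow> i < n \<Longrightarrow> j < n \<Longrightarrow> (\<Sum>k\<in>stab x. \<rho> k $$ (i, j)) = 0"
      by (rule K.subgroup_character_sum[OF rep stab_subgroup[OF x] fin_stab]) blast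
    then show "\<exists>r::nat. (\<Sum>k\<in>stab x. \<Sum>i<n. \<rho> k $$ (i, i)) = of_nat (card (stab x) * r) \<and>
      (r = 0 \<longrightarrow> (\<forall>i<n. \<forall>j<n. (\<Sum>k\<in>stab x. \<rho> k $$ (i, j)) = 0))"
      by blast
  qed
  from bchoice[OF this] obtain r where r: "\<And>x. x \<in> carrier G \<Longrightarrow>
      (\<Sum>k\<in>stab x. \<Sum>i<n. \<rho> k $$ (i, i)) = of_nat (card (stab x) * r x)"
    and r0: "\<And>x i j. x \<in> carrier G \<Longrightarrow> r x = 0 \<Longrightarrow> i < n \<Longrightarrow> j < n \<Longrightarrow>
      (\<Sum>k\<in>stab x. \<rho> k $$ (i, j)) = 0"
    by blast
  have "of_nat (\<Sum>x\<in>carrier G. card (stab x) * r x) = (0 :: complex)"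
    using total r by simp
  then have "(\<Sum>x\<in>carrier G. card (stab x) * r x) = 0" by (simp only: of_nat_eq_0_iff)
  then have "card (stab x) * r x = 0" if "x \<in> carrier G" for x
    using that finite_carrier by simp
  moreover have "card (stab x) > 0" if "x \<in> carrier G" for x
    using subgroup.one_closed[OF stab_subgroup[OF that]] fin_stab unfolding card_gt_0_iff by blast
  ultimately have r_zero: "r x = 0" if "x \<in> carrier G" for x
    using that by (metis mult_is_0 less_numeral_extra(3))
  define c :: complex where "c = of_nat n / of_nat (card H)"
  define z where "z = (\<lambda>h. if h \<in> H then c * \<rho> (inv h) $$ (0, 0) else 0)"
  have zB: "z \<in> B" by (simp add: B_iff z_def)
  have "z \<star> z = z"
  proof (rule group_algebra_eqI[OF conv_closed B_subset[OF zB]])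
    fix x assume x: "x \<in> carrier G"
    show "(z \<star> z) x = z x"
    proof (cases "x \<in> H")
      case False
      then show ?thesis using B_conv_closed[OF zB zB] by (simp add: B_iff z_def)
    next
      case True
      have orth: "(\<Sum>y\<in>H. \<rho> (inv y) $$ (0, 0) * \<rho> y $$ (l, 0)) = (if l = 0 then 1 / c else 0)"
        if "l < n" for l
      proof -
        have "(\<Sum>y\<in>H. \<rho> (inv y) $$ (0, 0) * \<rho> y $$ (l, 0)) =
            (\<Sum>y\<in>carrier K. \<rho> (inv\<^bsub>K\<^esub> y) $$ (0, 0) * \<rho> y $$ (l, 0))"
          by (simp add: inv_K)
        also have "\<dots> = (if l = 0 then 1 / c else 0)"
          using K.schur_orthogonality[OF _ irr n n that n] finite_H by (auto simp: c_def)
        finally show ?thesis .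
      qed
      have "(z \<star> z) x = (\<Sum>y\<in>H. z y * z (inv y \<otimes> x))"
        unfolding conv_left[OF x] using finite_carrier H.subset
        by (intro sum.mono_neutral_right) (auto simp: z_def)
      also have "\<dots> = (\<Sum>y\<in>H. c * c * (\<rho> (inv y) $$ (0, 0) * \<rho> (inv x \<otimes> y) $$ (0, 0)))"
        using True by (intro sum.cong) (auto simp: z_def inv_mult_group)
      also have "\<dots> = c * c * (\<Sum>y\<in>H. \<Sum>l<n. \<rho> (inv x) $$ (0, l) * (\<rho> (inv y) $$ (0, 0) * \<rho> y $$ (l, 0)))"
        using True n by (simp add: mult sum_distrib_left mult.assoc mult.left_commute)
      also have "\<dots> = c * c * (\<Sum>l<n. \<rho> (inv x) $$ (0, l) * (\<Sum>y\<in>H. \<rho> (inv y) $$ (0, 0) * \<rho> y $$ (l, 0)))"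
        by (subst sum.swap) (simp add: sum_distrib_left)
      also have "\<dots> = c * c * (\<Sum>l<n. if l = 0 then \<rho> (inv x) $$ (0, 0) / c else 0)"
        by (intro arg_cong2[where f = "(*)"] sum.cong refl) (auto simp: orth)
      also have "\<dots> = z x" using True n card_H by (simp add: z_def c_def)
      finally show ?thesis .
    qed
  qed
  moreover have "z \<noteq> \<zero>\<^bsub>A\<^esub>"
  proof
    assume "z = \<zero>\<^bsub>A\<^esub>"
    then have "z \<one> = 0" by (simp add: group_algebra_simps(4))
    moreover have "\<rho> \<one> = 1\<^sub>m n" using rep by (simp add: K.matrix_rep_iff)
    ultimately show False using n card_H by (simp add: z_def c_def)
  qed
  moreover have "\<forall>x\<in>carrier G. z \<star> ind (stab x) = \<zero>\<^bsub>A\<^esub>"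
  proof
    fix x assume x: "x \<in> carrier G"
    have zi: "z \<star> ind (stab x) \<in> B" by (intro B_conv_closed zB ind_in_B stab_subset)
    show "z \<star> ind (stab x) = \<zero>\<^bsub>A\<^esub>"
    proof (rule group_algebra_eqI[OF conv_closed A.zero_closed])
      fix y assume y: "y \<in> carrier G"
      show "(z \<star> ind (stab x)) y = \<zero>\<^bsub>A\<^esub> y"
      proof (cases "y \<in> H")
        case False
        then show ?thesis using zi by (simp add: B_iff group_algebra_simps(4))
      next
        case True
        have "(z \<star> ind (stab x)) y = (\<Sum>k\<in>stab x. z (y \<otimes> inv k))"
          using y by (intro conv_ind_right stab_subset)
        also have "\<dots> = (\<Sum>k\<in>stab x. c * (\<Sum>l<n. \<rho> k $$ (0, l) * \<rho> (inv y) $$ (l, 0)))"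
        proof (intro sum.cong refl)
          fix k assume "k \<in> stab x"
          then have k: "k \<in> H" using stab_subset by auto
          have "z (y \<otimes> inv k) = c * \<rho> (k \<otimes> inv y) $$ (0, 0)"
            using k True by (simp add: z_def inv_mult_group)
          then show "z (y \<otimes> inv k) = c * (\<Sum>l<n. \<rho> k $$ (0, l) * \<rho> (inv y) $$ (l, 0))"
            using k True n by (simp add: mult)
        qed
        also have "\<dots> = c * (\<Sum>l<n. (\<Sum>k\<in>stab x. \<rho> k $$ (0, l)) * \<rho> (inv y) $$ (l, 0))"
          by (simp add: sum_distrib_left[symmetric] sum_distrib_right) (subst sum.swap, simp)
        also have "\<dots> = 0" using r0[OF x r_zero[OF x] n] by simp
        finally show ?thesis by (simp add: group_algebra_simps(4))
      qed
    qed
  qed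
  ultimately show ?thesis using that[of z] zB annihilates_iff[OF zB] by blast
qed

section \<open>Containments between the sets Theta\<close>

lemma E_bulletD:
  assumes "e \<in> E_bullet G H"
  shows "e \<in> B" "e \<in> carrier A" "e \<star> e = e" "\<eta> \<star> e = \<eta>" "e \<star> \<eta> = \<eta>"
proof -
  show e: "e \<in> B" and "e \<star> e = e" "\<eta> \<star> e = \<eta>" using assms by (auto simp: E_bullet_def)
  then show "e \<in> carrier A" "e \<star> \<eta> = \<eta>" using B_subset eta_central by auto
qed

lemma Theta_iff:
  "w \<in> Theta G H e \<longleftrightarrow> w \<in> carrier A \<and> e \<star> w \<star> (\<one>\<^bsub>A\<^esub> \<ominus>\<^bsub>A\<^esub> e) = \<zero>\<^bsub>A\<^esub> \<and>
    (e \<ominus>\<^bsub>A\<^esub> \<eta>) \<star> w \<star> \<eta> = \<zero>\<^bsub>A\<^esub>"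
  by (simp add: Theta_def Let_def)

lemma B_minus_closed:
  assumes "f \<in> B" "g \<in> B"
  shows "f \<ominus>\<^bsub>A\<^esub> g \<in> B"
  using assms group_algebra_minus[OF is_group finite_carrier B_subset B_subset, of f g]
  by (simp add: B_iff)

lemma one_in_B: "\<one>\<^bsub>A\<^esub> \<in> B"
  by (auto simp: B_iff group_algebra_simps(3))

lemmas minus_eq = group_algebra_minus[OF is_group finite_carrier]

lemma diff_eq_zeroD:
  assumes "a \<in> carrier A" "b \<in> carrier A" "a \<ominus>\<^bsub>A\<^esub> b = \<zero>\<^bsub>A\<^esub>"
  shows "a = b"
  using assms minus_eq[OF assms(1,2)] by (simp add: group_algebra_simps(4) fun_eq_iff)

lemma diff_diff_cancel:
  assumes "a \<in> carrier A" "b \<in> carrier A" "c \<in> carrier A"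
  shows "(a \<ominus>\<^bsub>A\<^esub> c) \<ominus>\<^bsub>A\<^esub> (b \<ominus>\<^bsub>A\<^esub> c) = a \<ominus>\<^bsub>A\<^esub> b"
proof -
  have "(a \<ominus>\<^bsub>A\<^esub> c) \<ominus>\<^bsub>A\<^esub> (b \<ominus>\<^bsub>A\<^esub> c) = (\<lambda>x. (a \<ominus>\<^bsub>A\<^esub> c) x - (b \<ominus>\<^bsub>A\<^esub> c) x)"
    using assms by (intro minus_eq) auto
  then show ?thesis using assms by (simp add: minus_eq)
qed

lemma eta_A: "\<eta> \<in> carrier A"
  by (rule B_subset[OF eta_in_B])

text \<open>This and the next lemma exhibit two of the Peirce components of \<open>\<Theta>(e)\<close> with respect to the orthogonal idempotents
\<open>\<eta>\<close>, \<open>e - \<eta>\<close> and \<open>1 - e\<close>: the full rows of \<open>1 - e\<close> here, the full columns of \<open>e - \<eta>\<close> below. They are enough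
to recover the left ideal of \<open>e\<close>.\<close>

lemma complement_in_Theta:
  assumes e: "e \<in> E_bullet G H" and a: "a \<in> carrier A"
  shows "(\<one>\<^bsub>A\<^esub> \<ominus>\<^bsub>A\<^esub> e) \<star> a \<in> Theta G H e"
proof -
  note E = E_bulletD[OF e]
  let ?d = "\<one>\<^bsub>A\<^esub> \<ominus>\<^bsub>A\<^esub> e"
  have d: "?d \<in> carrier A" using E by simp
  have ed: "e \<star> ?d = \<zero>\<^bsub>A\<^esub>" using E by (simp add: A.diff_mult_distrib)
  have nd: "\<eta> \<star> ?d = \<zero>\<^bsub>A\<^esub>" using E eta_A by (simp add: A.diff_mult_distrib)
  have fd: "(e \<ominus>\<^bsub>A\<^esub> \<eta>) \<star> ?d = \<zero>\<^bsub>A\<^esub>"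
    using E eta_A d ed nd by (simp add: A.diff_mult_distrib(1))
  have "e \<star> (?d \<star> a) = \<zero>\<^bsub>A\<^esub>" "(e \<ominus>\<^bsub>A\<^esub> \<eta>) \<star> (?d \<star> a) = \<zero>\<^bsub>A\<^esub>"
    using E eta_A d a ed fd by (simp_all add: A.m_assoc[symmetric])
  then show ?thesis using d a eta_A by (simp add: Theta_iff)
qed

lemma corner_in_Theta:
  assumes e: "e \<in> E_bullet G H" and a: "a \<in> carrier A"
  shows "a \<star> (e \<ominus>\<^bsub>A\<^esub> \<eta>) \<in> Theta G H e"
proof -
  note E = E_bulletD[OF e]
  let ?f = "e \<ominus>\<^bsub>A\<^esub> \<eta>"
  have f: "?f \<in> carrier A" using E eta_A by simp
  have fn: "?f \<star> \<eta> = \<zero>\<^bsub>A\<^esub>" using E eta_A eta_idem by (simp add: A.diff_mult_distrib)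
  have fe: "?f \<star> e = ?f" using E eta_A by (simp add: A.diff_mult_distrib)
  have fd: "?f \<star> (\<one>\<^bsub>A\<^esub> \<ominus>\<^bsub>A\<^esub> e) = \<zero>\<^bsub>A\<^esub>"
    using E f fe by (simp add: A.diff_mult_distrib(2))
  have "e \<star> (a \<star> ?f) \<star> (\<one>\<^bsub>A\<^esub> \<ominus>\<^bsub>A\<^esub> e) = e \<star> a \<star> (?f \<star> (\<one>\<^bsub>A\<^esub> \<ominus>\<^bsub>A\<^esub> e))"
    "?f \<star> (a \<star> ?f) \<star> \<eta> = ?f \<star> a \<star> (?f \<star> \<eta>)"
    using E f a eta_A by (simp_all add: A.m_assoc)
  then show ?thesis using E f a fn fd by (simp add: Theta_iff)
qed

text \<open>For \<open>a \<in> \<complex>[G]\<close>, the second condition of \<open>\<Theta>(e')\<close> at \<open>(1 - e)a\<close> reads \<open>(e' - e'e) a \<eta> = 0\<close>, and the first one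
at \<open>a(e - \<eta>)\<close>, multiplied by \<open>\<eta>\<close> from the left, reads \<open>\<eta> a (e - ee') = 0\<close>.\<close>

lemma Theta_subset_imp_left_ideal_eq:
  assumes full: "full_induction_restriction G H"
    and e: "e \<in> E_bullet G H" and e': "e' \<in> E_bullet G H"
    and le: "Theta G H e \<subseteq> Theta G H e'"
  shows "left_ideal G e = left_ideal G e'"
proof -
  note E = E_bulletD[OF e] and E' = E_bulletD[OF e']
  note [simp] = eta_A
  have "e' \<ominus>\<^bsub>A\<^esub> e' \<star> e = \<zero>\<^bsub>A\<^esub>"
  proof (rule faithful_if_full[OF full])
    show "e' \<ominus>\<^bsub>A\<^esub> e' \<star> e \<in> B" using E E' by (intro B_minus_closed B_conv_closed)
    fix a assume a: "a \<in> carrier A"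
    have "(e' \<ominus>\<^bsub>A\<^esub> \<eta>) \<star> (\<one>\<^bsub>A\<^esub> \<ominus>\<^bsub>A\<^esub> e) = (e' \<ominus>\<^bsub>A\<^esub> \<eta>) \<ominus>\<^bsub>A\<^esub> (e' \<star> e \<ominus>\<^bsub>A\<^esub> \<eta>)"
      using E E' by (simp add: A.diff_mult_distrib)
    also have "\<dots> = e' \<ominus>\<^bsub>A\<^esub> e' \<star> e"
      using E E' by (simp add: diff_diff_cancel)
    finally have "(e' \<ominus>\<^bsub>A\<^esub> e' \<star> e) \<star> a \<star> \<eta> =
        (e' \<ominus>\<^bsub>A\<^esub> \<eta>) \<star> ((\<one>\<^bsub>A\<^esub> \<ominus>\<^bsub>A\<^esub> e) \<star> a) \<star> \<eta>"
      using E E' a by (simp add: A.m_assoc[symmetric])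
    also have "\<dots> = \<zero>\<^bsub>A\<^esub>"
      using le complement_in_Theta[OF e a] by (auto simp: Theta_iff)
    finally show "(e' \<ominus>\<^bsub>A\<^esub> e' \<star> e) \<star> a \<star> \<eta> = \<zero>\<^bsub>A\<^esub>" .
  qed
  from diff_eq_zeroD[OF _ _ this] have e'e: "e' = e' \<star> e" using E E' by simp
  have "e \<ominus>\<^bsub>A\<^esub> e \<star> e' = \<zero>\<^bsub>A\<^esub>"
  proof (rule faithful_if_full_right[OF full])
    show "e \<ominus>\<^bsub>A\<^esub> e \<star> e' \<in> B" using E E' by (intro B_minus_closed B_conv_closed)
    fix a assume a: "a \<in> carrier A"
    let ?f = "e \<ominus>\<^bsub>A\<^esub> \<eta>" and ?d = "\<one>\<^bsub>A\<^esub> \<ominus>\<^bsub>A\<^esub> e'"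
    have fd: "?f \<in> carrier A" "?d \<in> carrier A" using E E' by auto
    have "?f \<star> ?d = ?f \<ominus>\<^bsub>A\<^esub> (e \<star> e' \<ominus>\<^bsub>A\<^esub> \<eta>)"
      using E E' by (simp add: A.diff_mult_distrib)
    also have "\<dots> = e \<ominus>\<^bsub>A\<^esub> e \<star> e'"
      using E E' by (simp add: diff_diff_cancel)
    finally have "\<eta> \<star> a \<star> (e \<ominus>\<^bsub>A\<^esub> e \<star> e') = (\<eta> \<star> e') \<star> a \<star> (?f \<star> ?d)"
      using E' by simp
    also have "\<dots> = \<eta> \<star> (e' \<star> (a \<star> ?f) \<star> ?d)"
      using E'(2) fd a by (simp only: A.m_assoc A.m_closed eta_A)
    also have "e' \<star> (a \<star> ?f) \<star> ?d = \<zero>\<^bsub>A\<^esub>"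
      using le corner_in_Theta[OF e a] by (auto simp: Theta_iff)
    finally show "\<eta> \<star> a \<star> (e \<ominus>\<^bsub>A\<^esub> e \<star> e') = \<zero>\<^bsub>A\<^esub>" by simp
  qed
  from diff_eq_zeroD[OF _ _ this] have ee': "e = e \<star> e'" using E E' by simp
  have "a \<star> e \<in> left_ideal G e'" if "a \<in> carrier A" for a
    unfolding left_ideal_def
    by (rule image_eqI[of _ _ "a \<star> e"]) (use that E E' in \<open>simp_all add: A.m_assoc ee'[symmetric]\<close>)
  moreover have "a \<star> e' \<in> left_ideal G e" if "a \<in> carrier A" for a
    unfolding left_ideal_def
    by (rule image_eqI[of _ _ "a \<star> e'"]) (use that E E' in \<open>simp_all add: A.m_assoc e'e[symmetric]\<close>)
  ultimately show ?thesis by (auto simp: left_ideal_def)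
qed

text \<open>The witnesses are \<open>1 - z\<close> and \<open>1\<close>, where \<open>z\<close> is a nonzero idempotent annihilating \<open>\<complex>[G]\<eta>\<close>.\<close>

lemma not_full_imp_redundant:
  assumes "\<not> full_induction_restriction G H"
  shows "\<exists>e\<in>E_bullet G H. \<exists>e'\<in>E_bullet G H.
    Theta G H e \<subseteq> Theta G H e' \<and> left_ideal G e \<noteq> left_ideal G e'"
proof -
  obtain z where z: "z \<in> B" "z \<star> z = z" "z \<noteq> \<zero>\<^bsub>A\<^esub>"
    and annih: "\<And>w. w \<in> carrier A \<Longrightarrow> z \<star> w \<star> \<eta> = \<zero>\<^bsub>A\<^esub>"
    using annihilating_idempotent[OF assms] by blast
  note [simp] = eta_A
  have zA: "z \<in> carrier A" using z by (intro B_subset)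
  have "z \<star> \<eta> = \<zero>\<^bsub>A\<^esub>" using annih[of "\<one>\<^bsub>A\<^esub>"] zA by simp
  then have nz: "\<eta> \<star> z = \<zero>\<^bsub>A\<^esub>" using eta_central z by simp
  let ?e = "\<one>\<^bsub>A\<^esub> \<ominus>\<^bsub>A\<^esub> z"
  have ez: "?e \<star> z = \<zero>\<^bsub>A\<^esub>" using z zA by (simp add: A.diff_mult_distrib)
  have "?e \<star> ?e = ?e"
    using zA ez A.diff_mult_distrib(2)[of "\<one>\<^bsub>A\<^esub>" z ?e] by (simp add: A.diff_zero)
  moreover have "\<eta> \<star> ?e = \<eta>" using zA nz by (simp add: A.diff_mult_distrib A.diff_zero)
  moreover have "?e \<in> B" using z one_in_B by (intro B_minus_closed)
  ultimately have e: "?e \<in> E_bullet G H" by (simp add: E_bullet_def)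
  have one: "\<one>\<^bsub>A\<^esub> \<in> E_bullet G H" using one_in_B by (simp add: E_bullet_def)
  have "w \<in> Theta G H \<one>\<^bsub>A\<^esub>" if w: "w \<in> Theta G H ?e" for w
  proof -
    have wA: "w \<in> carrier A" and "(?e \<ominus>\<^bsub>A\<^esub> \<eta>) \<star> w \<star> \<eta> = \<zero>\<^bsub>A\<^esub>" using w by (auto simp: Theta_iff)
    then have "w \<star> \<eta> \<ominus>\<^bsub>A\<^esub> z \<star> w \<star> \<eta> \<ominus>\<^bsub>A\<^esub> \<eta> \<star> w \<star> \<eta> = \<zero>\<^bsub>A\<^esub>"
      using zA by (simp add: A.diff_mult_distrib)
    then have "(\<one>\<^bsub>A\<^esub> \<ominus>\<^bsub>A\<^esub> \<eta>) \<star> w \<star> \<eta> = \<zero>\<^bsub>A\<^esub>"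
      using zA wA annih[OF wA] by (simp add: A.diff_mult_distrib A.diff_zero)
    then show ?thesis using wA by (simp add: Theta_iff A.diff_mult_distrib(2))
  qed
  moreover have "left_ideal G ?e \<noteq> left_ideal G \<one>\<^bsub>A\<^esub>"
  proof
    assume "left_ideal G ?e = left_ideal G \<one>\<^bsub>A\<^esub>"
    moreover have "z \<in> left_ideal G \<one>\<^bsub>A\<^esub>"
      unfolding left_ideal_def by (rule image_eqI[of _ _ z]) (use zA in simp_all)
    ultimately obtain a where a: "a \<in> carrier A" "z = a \<star> ?e" by (auto simp: left_ideal_def)
    have "z \<star> z = a \<star> ?e \<star> z" by (rule arg_cong[OF a(2), of "\<lambda>y. y \<star> z"])
    also have "\<dots> = a \<star> (?e \<star> z)" using zA a(1) by (intro A.m_assoc) auto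
    finally show False using ez a(1) z by simp
  qed
  ultimately show ?thesis using e one by blast
qed

end

theorem proposition1p8:
  fixes G (structure) and H :: "'a set"
  assumes "group G" and "finite (carrier G)" and "subgroup H G"
  shows "full_induction_restriction G H \<longleftrightarrow>
    (\<forall>e\<in>E_bullet G H. \<forall>e'\<in>E_bullet G H.
       Theta G H e \<subseteq> Theta G H e' \<longrightarrow> left_ideal G e = left_ideal G e')"
proof -
  interpret finite_group_with_subgroup G H
    using assms by (simp add: finite_group_with_subgroup_def finite_group_with_subgroup_axioms_def)
  show ?thesis
    using Theta_subset_imp_left_ideal_eq not_full_imp_redundant by blast
qed

end
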